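(* Let $d\mu$ be a non-trivial $l\times l$ matrix-valued measure on $\mathbb R$ with $E=\operatorname{supp}(d\mu)$ compact, and let $(A_n,B_n)_{n\ge1}$ be Jacobi parameters of $d\mu$. Then, with $C(E)$ the logarithmic capacity of $E$, $$\limsup_{n\to\infty}\,|\det(A_1\cdots A_n)|^{1/n}\le C(E)^l.$$
   Context: Fix $l\ge1$; $^\dagger$ is the Hermitian adjoint, $\mathbf 1$ the $l\times l$ identity. Measures are positive semi-definite $l\times l$ matrix-valued, normalized by $\mu(\mathbb R)=\mathbf 1$. With $\langle\!\langle f,g\rangle\!\rangle_R=\int f(x)^\dagger\,d\mu(x)\,g(x)$, the measure is non-trivial if $\operatorname{Tr}\langle\!\langle f,f\rangle\!\rangle_R>0$ for every non-zero polynomial $f$ with $l\times l$ matrix coefficients. Let $(p_n^R)_{n\ge0}$ be right orthonormal matrix polynomials: $\deg p_n^R=n$, $p_0^R=\mathbf 1$, $\langle\!\langle p_n^R,p_m^R\rangle\!\rangle_R=\delta_{nm}\mathbf 1$ (each $p_n^R$, $n\ge1$, is unique up to right multiplication by a unitary). Jacobi parameters of $d\mu$ are $B_n=\langle\!\langle p_{n-1}^R,xp_{n-1}^R\rangle\!\rangle_R$, $A_n=\langle\!\langle p_{n-1}^R,xp_n^R\rangle\!\rangle_R$, $n\ge1$; $|\det(A_1\cdots A_n)|$ does not depend on the choice of the $p_n^R$. *)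

theory Defs
  imports "HOL-Probability.Probability" "HOL-Computational_Algebra.Polynomial"
begin

section \<open>Matrix-valued measures on the real line\<close>

type_synonym 'l cmat = "complex ^ 'l ^ 'l"

definition adj :: "'l::finite cmat \<Rightarrow> 'l cmat" where
  "adj A = (\<chi> i j. cnj (A $ j $ i))"

definition psd :: "'l::finite cmat \<Rightarrow> bool" where
  "psd A \<longleftrightarrow> adj A = A \<and> (\<forall>v. 0 \<le> Re (\<Sum>i\<in>UNIV. cnj (v $ i) * (A *v v) $ i))"

text \<open>The total mass is the identity matrix \<open>mat 1\<close>; the numeral \<open>1\<close> of the vector type is the
  all-ones matrix, and \<open>*\<close> is the entrywise product, so neither is used for matrices here.\<close>

definition matrix_measure :: "(real set \<Rightarrow> 'l::finite cmat) \<Rightarrow> bool" where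
  "matrix_measure \<mu> \<longleftrightarrow>
     (\<forall>X\<in>sets borel. psd (\<mu> X)) \<and>
     (\<forall>F :: nat \<Rightarrow> real set. range F \<subseteq> sets borel \<longrightarrow> disjoint_family F \<longrightarrow>
        (\<lambda>n. \<mu> (F n)) sums \<mu> (\<Union>n. F n)) \<and>
     \<mu> UNIV = mat 1"

definition matrix_supp :: "(real set \<Rightarrow> 'l::finite cmat) \<Rightarrow> real set" where
  "matrix_supp \<mu> = {x. \<forall>U. open U \<longrightarrow> x \<in> U \<longrightarrow> \<mu> U \<noteq> 0}"

text \<open>Integration against \<open>\<mu>\<close> is done through \<open>d\<mu> = M d(Tr \<mu>)\<close>, with \<open>M\<close> a Radon-Nikodym
  density of \<open>\<mu>\<close> with respect to its trace measure. Such an \<open>M\<close> exists and is unique up to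
  null sets (lemmas \<open>is_trace_density_trace_density\<close> and \<open>trace_density_unique\<close> below), so the
  choice in \<open>trace_density\<close> does not affect any integral.\<close>

definition trace_measure :: "(real set \<Rightarrow> 'l::finite cmat) \<Rightarrow> real measure" where
  "trace_measure \<mu> = measure_of UNIV (sets borel) (\<lambda>X. ennreal (Re (trace (\<mu> X))))"

definition is_trace_density ::
  "(real set \<Rightarrow> 'l::finite cmat) \<Rightarrow> (real \<Rightarrow> 'l cmat) \<Rightarrow> bool" where
  "is_trace_density \<mu> M \<longleftrightarrow>
     integrable (trace_measure \<mu>) M \<and>
     (\<forall>X\<in>sets borel. \<mu> X = (LINT x:X|trace_measure \<mu>. M x))"

definition trace_density :: "(real set \<Rightarrow> 'l::finite cmat) \<Rightarrow> real \<Rightarrow> 'l cmat" where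
  "trace_density \<mu> = (SOME M. is_trace_density \<mu> M)"

definition right_inner ::
  "(real set \<Rightarrow> 'l::finite cmat) \<Rightarrow> (real \<Rightarrow> 'l cmat) \<Rightarrow> (real \<Rightarrow> 'l cmat) \<Rightarrow> 'l cmat" where
  "right_inner \<mu> f g =
     (LINT x|trace_measure \<mu>. adj (f x) ** trace_density \<mu> x ** g x)"


section \<open>Matrix polynomials and Jacobi parameters\<close>

text \<open>A matrix polynomial in a real variable is given by its coefficient sequence. The
  function \<open>poly\<close> cannot evaluate it, since its argument would be a matrix.\<close>

definition mpoly_eval :: "'l::finite cmat poly \<Rightarrow> real \<Rightarrow> 'l cmat" where
  "mpoly_eval p x = (\<Sum>i\<le>degree p. x ^ i *\<^sub>R coeff p i)"

definition nontrivial_measure :: "(real set \<Rightarrow> 'l::finite cmat) \<Rightarrow> bool" where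
  "nontrivial_measure \<mu> \<longleftrightarrow>
     (\<forall>f. f \<noteq> 0 \<longrightarrow> Re (trace (right_inner \<mu> (mpoly_eval f) (mpoly_eval f))) > 0)"

definition right_orthonormal ::
  "(real set \<Rightarrow> 'l::finite cmat) \<Rightarrow> (nat \<Rightarrow> 'l cmat poly) \<Rightarrow> bool" where
  "right_orthonormal \<mu> p \<longleftrightarrow>
     (\<forall>n. degree (p n) = n) \<and> p 0 = [:mat 1:] \<and>
     (\<forall>n m. right_inner \<mu> (mpoly_eval (p n)) (mpoly_eval (p m)) = (if n = m then mat 1 else 0))"

definition jacobi_parameters ::
  "(real set \<Rightarrow> 'l::finite cmat) \<Rightarrow> (nat \<Rightarrow> 'l cmat) \<Rightarrow> (nat \<Rightarrow> 'l cmat) \<Rightarrow> bool" where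
  "jacobi_parameters \<mu> A B \<longleftrightarrow>
     (\<exists>p. right_orthonormal \<mu> p \<and>
        (\<forall>n\<ge>1.
           B n = right_inner \<mu> (mpoly_eval (p (n - 1))) (\<lambda>x. x *\<^sub>R mpoly_eval (p (n - 1)) x) \<and>
           A n = right_inner \<mu> (mpoly_eval (p (n - 1))) (\<lambda>x. x *\<^sub>R mpoly_eval (p n) x)))"

text \<open>The ordered product \<open>A 1 ** \<dots> ** A n\<close>.\<close>

primrec mat_prod_upto :: "(nat \<Rightarrow> 'l::finite cmat) \<Rightarrow> nat \<Rightarrow> 'l cmat" where
  "mat_prod_upto A 0 = mat 1"
| "mat_prod_upto A (Suc n) = mat_prod_upto A n ** A (Suc n)"


section \<open>Logarithmic capacity\<close>

text \<open>The logarithmic kernel is \<open>+\<infinity>\<close> on the diagonal (in HOL, \<open>ln 0 = 0\<close>).\<close>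

definition log_kernel :: "real \<Rightarrow> real \<Rightarrow> ereal" where
  "log_kernel x y = (if x = y then \<infinity> else ereal (- ln \<bar>x - y\<bar>))"

text \<open>Positive part minus negative part, as \<open>e2ennreal\<close> sends negative numbers to \<open>0\<close>. The
  negative part is finite for measures on a bounded set.\<close>

definition log_energy :: "real measure \<Rightarrow> ereal" where
  "log_energy \<rho> =
     enn2ereal (\<integral>\<^sup>+x. \<integral>\<^sup>+y. e2ennreal (log_kernel x y) \<partial>\<rho> \<partial>\<rho>) -
     enn2ereal (\<integral>\<^sup>+x. \<integral>\<^sup>+y. e2ennreal (- log_kernel x y) \<partial>\<rho> \<partial>\<rho>)"

text \<open>Logarithmic capacity of a compact set, \<open>exp (- \<infinity>)\<close> being \<open>0\<close>.\<close>

definition log_capacity :: "real set \<Rightarrow> real" where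
  "log_capacity E =
     (let V = (INF \<rho>\<in>{\<rho>. prob_space \<rho> \<and> sets \<rho> = sets borel \<and> emeasure \<rho> E = 1}. log_energy \<rho>)
      in if V = \<infinity> then 0 else exp (- real_of_ereal V))"


section \<open>Existence and uniqueness of the trace density\<close>

lemma quadratic_form_eq_inner:
  fixes A :: "'l::finite cmat"
  shows "Re (\<Sum>i\<in>UNIV. cnj (v $ i) * (A *v v) $ i) = v \<bullet> (A *v v)"
  by (simp add: inner_vec_def inner_complex_def)

lemma psd_pair:
  fixes A :: "'l::finite cmat"
  assumes "psd A" "cmod c = 1"
  shows "0 \<le> Re (A $ i $ i) + Re (A $ j $ j) + 2 * Re (c * A $ i $ j)"
proof -
  let ?v = "axis i 1 + axis j c :: complex ^ 'l"
  have vj: "(A *v axis j c) $ k = A $ k $ j * c" for k j c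
    by (simp add: matrix_vector_mult_def axis_def if_distrib cong: if_cong)
  have h: "A $ j $ i = cnj (A $ i $ j)"
    using assms(1) unfolding psd_def adj_def vec_eq_iff by simp
  have c2: "(Re c)\<^sup>2 + (Im c)\<^sup>2 = 1"
    using assms(2) by (metis cmod_power2 one_power2)
  have "0 \<le> ?v \<bullet> (A *v ?v)"
    using assms(1) unfolding psd_def quadratic_form_eq_inner by blast
  also have "\<dots> = Re (A $ i $ i) + ((Re c)\<^sup>2 + (Im c)\<^sup>2) * Re (A $ j $ j) + 2 * Re (c * A $ i $ j)"
    by (simp add: matrix_vector_right_distrib inner_add_left inner_axis' vj h inner_complex_def
        algebra_simps power2_eq_square)
  finally show ?thesis using c2 by simp
qed

lemma psd_diag:
  fixes A :: "'l::finite cmat"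
  assumes "psd A"
  shows "0 \<le> Re (A $ i $ i)"
  using psd_pair[OF assms, of 1 i i] by simp

lemma psd_trace:
  fixes A :: "'l::finite cmat"
  assumes "psd A"
  shows "0 \<le> Re (trace A)"
  by (simp add: trace_def sum_nonneg psd_diag[OF assms])

lemma psd_entry_bound:
  fixes A :: "'l::finite cmat"
  assumes "psd A" "cmod c = 1"
  shows "\<bar>Re (c * A $ i $ j)\<bar> \<le> Re (trace A)"
proof -
  have d: "Re (A $ k $ k) \<le> Re (trace A)" for k
    unfolding trace_def Re_sum by (rule member_le_sum) (auto simp: psd_diag[OF assms(1)])
  show ?thesis
    using psd_pair[OF assms, of i j] psd_pair[OF assms(1), of "- c" i j] assms(2) d[of i] d[of j]
    by auto
qed

lemma psd_basis_bound:
  fixes A :: "'l::finite cmat"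
  assumes "psd A" "b \<in> Basis"
  shows "\<bar>A \<bullet> b\<bar> \<le> Re (trace A)"
proof -
  obtain i j c where b: "b = axis i (axis j c)" "c \<in> Basis"
    using assms(2) unfolding Basis_vec_def by auto
  have "A \<bullet> b = Re (cnj c * A $ i $ j)" "cmod (cnj c) = 1"
    using b(2) by (auto simp: b(1) inner_axis inner_complex_def Basis_complex_def)
  then show ?thesis using psd_entry_bound[OF assms(1)] by metis
qed

lemma bounded_linear_Re_trace: "bounded_linear (\<lambda>A :: 'l::finite cmat. Re (trace A))"
  unfolding trace_def
  by (intro bounded_linear_compose[OF bounded_linear_Re] bounded_linear_sum
      bounded_linear_compose[OF bounded_linear_vec_nth] bounded_linear_vec_nth)

lemma emeasure_functional:
  assumes \<mu>: "matrix_measure \<mu>" and \<phi>: "bounded_linear \<phi>"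
    and pos: "\<And>A. psd A \<Longrightarrow> 0 \<le> \<phi> A" and X: "X \<in> sets borel"
  shows "emeasure (measure_of UNIV (sets borel) (\<lambda>X. ennreal (\<phi> (\<mu> X)))) X = ennreal (\<phi> (\<mu> X))"
proof (rule emeasure_measure_of_sigma)
  have "(\<lambda>n::nat. \<mu> {}) sums \<mu> {}"
    using \<mu> unfolding matrix_measure_def
    by (elim conjE allE[where x = "\<lambda>n. {}"]) (auto simp: disjoint_family_on_def)
  then have "(\<lambda>n::nat. \<mu> {}) \<longlonglongrightarrow> 0"
    using summable_LIMSEQ_zero sums_summable by blast
  then have "\<mu> {} = 0" by (simp add: LIMSEQ_const_iff)
  then show "positive (sets borel) (\<lambda>X. ennreal (\<phi> (\<mu> X)))"
    by (simp add: positive_def linear_simps(3)[OF \<phi>])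
  show "countably_additive (sets borel) (\<lambda>X. ennreal (\<phi> (\<mu> X)))"
  proof (rule countably_additiveI)
    fix F :: "nat \<Rightarrow> real set"
    assume F: "range F \<subseteq> sets borel" "disjoint_family F"
    then have "(\<lambda>n. \<phi> (\<mu> (F n))) sums \<phi> (\<mu> (\<Union>n. F n))"
      using \<mu> bounded_linear.sums[OF \<phi>] unfolding matrix_measure_def by blast
    moreover have "0 \<le> \<phi> (\<mu> (F n))" for n
      using F \<mu> pos unfolding matrix_measure_def by blast
    ultimately show "(\<Sum>n. ennreal (\<phi> (\<mu> (F n)))) = ennreal (\<phi> (\<mu> (\<Union>n. F n)))"
      by (intro suminf_ennreal_eq) auto
  qed
qed (use X sets.sigma_algebra_axioms[of borel] in auto)

lemma sets_trace_measure [measurable_cong, simp]: "sets (trace_measure \<mu>) = sets borel"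
  by (simp add: trace_measure_def sigma_algebra.sigma_sets_eq[OF sets.sigma_algebra_axioms[of borel, simplified]])

lemma space_trace_measure [simp]: "space (trace_measure \<mu>) = UNIV"
  by (simp add: trace_measure_def space_measure_of_conv)

lemma emeasure_trace_measure:
  assumes "matrix_measure \<mu>" "X \<in> sets borel"
  shows "emeasure (trace_measure \<mu>) X = ennreal (Re (trace (\<mu> X)))"
  unfolding trace_measure_def
  by (rule emeasure_functional[OF assms(1) bounded_linear_Re_trace psd_trace assms(2)])

lemma finite_trace_measure: "matrix_measure \<mu> \<Longrightarrow> finite_measure (trace_measure \<mu>)"
  by (rule finite_measureI) (simp add: emeasure_trace_measure)

lemma functional_density:
  assumes \<mu>: "matrix_measure \<mu>" and \<phi>: "bounded_linear \<phi>"
    and pos: "\<And>A. psd A \<Longrightarrow> 0 \<le> \<phi> A"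
    and bd: "\<And>A. psd A \<Longrightarrow> \<phi> A \<le> K * Re (trace A)"
  shows "\<exists>h. integrable (trace_measure \<mu>) h \<and>
    (\<forall>X\<in>sets borel. \<phi> (\<mu> X) = (LINT x:X|trace_measure \<mu>. (h x :: real)))"
proof -
  let ?T = "trace_measure \<mu>"
  define N where "N = measure_of UNIV (sets borel) (\<lambda>X. ennreal (\<phi> (\<mu> X)))"
  interpret T: finite_measure ?T by (rule finite_trace_measure[OF \<mu>])
  have eN: "emeasure N X = ennreal (\<phi> (\<mu> X))" if "X \<in> sets borel" for X
    unfolding N_def by (rule emeasure_functional[OF \<mu> \<phi> pos that])
  have sN: "sets N = sets borel"
    by (simp add: N_def sigma_algebra.sigma_sets_eq[OF sets.sigma_algebra_axioms[of borel, simplified]])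
  have psd: "psd (\<mu> X)" if "X \<in> sets borel" for X
    using \<mu> that unfolding matrix_measure_def by blast
  have fin: "finite_measure N"
    by (rule finite_measureI) (use eN[of UNIV] in \<open>simp add: N_def space_measure_of_conv\<close>)
  have "absolutely_continuous ?T N"
    unfolding absolutely_continuous_def
  proof
    fix X assume "X \<in> null_sets ?T"
    then have X: "X \<in> sets borel" "ennreal (Re (trace (\<mu> X))) = 0"
      by (auto simp: null_sets_def emeasure_trace_measure[OF \<mu>])
    then have "Re (trace (\<mu> X)) = 0"
      using psd_trace[OF psd[OF X(1)]] by simp
    then have "\<phi> (\<mu> X) = 0"
      using pos[OF psd[OF X(1)]] bd[OF psd[OF X(1)]] by simp
    then show "X \<in> null_sets N" using X(1) by (simp add: null_sets_def sN eN)
  qed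
  then obtain D where D: "D \<in> borel_measurable ?T" "AE x in ?T. RN_deriv ?T N x = ennreal (D x)"
    "AE x in N. 0 < D x" "\<And>x. 0 \<le> D x"
    using T.real_RN_deriv[OF fin] sN by (metis sets_trace_measure)
  have dens: "density ?T D = N"
  proof -
    have "density ?T (RN_deriv ?T N) = N"
      by (rule T.density_RN_deriv) (use \<open>absolutely_continuous ?T N\<close> sN in auto)
    moreover have "density ?T (RN_deriv ?T N) = density ?T D"
      by (rule density_cong) (use D in auto)
    ultimately show ?thesis by simp
  qed
  have nn: "(\<integral>\<^sup>+x. ennreal (indicator X x * D x) \<partial>?T) = ennreal (\<phi> (\<mu> X))" if "X \<in> sets borel" for X
  proof -
    have "(\<integral>\<^sup>+x. ennreal (indicator X x * D x) \<partial>?T) = (\<integral>\<^sup>+x. ennreal (D x) * indicator X x \<partial>?T)"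
      by (intro nn_integral_cong) (auto simp: indicator_def)
    also have "\<dots> = emeasure (density ?T D) X"
      by (rule emeasure_density[symmetric]) (use D that in auto)
    finally show ?thesis by (simp add: dens eN that)
  qed
  have "integrable ?T D"
    by (rule integrableI_nonneg) (use D nn[of UNIV] in auto)
  moreover have "\<phi> (\<mu> X) = (LINT x:X|?T. D x)" if "X \<in> sets borel" for X
  proof -
    have "(LINT x:X|?T. D x) = enn2real (\<integral>\<^sup>+x. ennreal (indicator X x * D x) \<partial>?T)"
      unfolding set_lebesgue_integral_def real_scaleR_def
      by (rule integral_eq_nn_integral) (use D that in auto)
    then show ?thesis by (simp add: nn that pos psd)
  qed
  ultimately show ?thesis by blast
qed

lemma trace_density_exists:
  fixes \<mu> :: "real set \<Rightarrow> 'l::finite cmat"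
  assumes \<mu>: "matrix_measure \<mu>"
  shows "\<exists>M. is_trace_density \<mu> M"
proof -
  let ?T = "trace_measure \<mu>"
  interpret T: finite_measure ?T by (rule finite_trace_measure[OF \<mu>])
  have "\<exists>h. integrable ?T h \<and>
      (\<forall>X\<in>sets borel. \<mu> X \<bullet> b + Re (trace (\<mu> X)) = (LINT x:X|?T. (h x :: real)))"
    if "b \<in> Basis" for b
  proof (rule functional_density[OF \<mu>])
    show "bounded_linear (\<lambda>A. A \<bullet> b + Re (trace A))"
      by (intro bounded_linear_add bounded_linear_inner_left bounded_linear_Re_trace)
    show "0 \<le> A \<bullet> b + Re (trace A)" "A \<bullet> b + Re (trace A) \<le> 2 * Re (trace A)" if "psd A" for A
      using psd_basis_bound[OF that \<open>b \<in> Basis\<close>] by auto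
  qed
  then obtain h where h: "\<And>b. b \<in> Basis \<Longrightarrow> integrable ?T (h b)"
    "\<And>b X. b \<in> Basis \<Longrightarrow> X \<in> sets borel \<Longrightarrow>
      \<mu> X \<bullet> b + Re (trace (\<mu> X)) = (LINT x:X|?T. (h b x :: real))"
    by metis
  define M where "M = (\<lambda>x. \<Sum>b\<in>Basis. (h b x - 1) *\<^sub>R b)"
  have intM: "integrable ?T M"
    unfolding M_def using h(1)
    by (intro Bochner_Integration.integrable_sum integrable_scaleR_left
        Bochner_Integration.integrable_diff) auto
  moreover have "\<mu> X = (LINT x:X|?T. M x)" if X: "X \<in> sets borel" for X
  proof (rule euclidean_eqI)
    fix b :: "'l cmat" assume b: "b \<in> Basis"
    have tr: "(LINT x:X|?T. (1::real)) = Re (trace (\<mu> X))"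
    proof -
      have "0 \<le> Re (trace (\<mu> X))"
        using X \<mu> psd_trace unfolding matrix_measure_def by blast
      then show ?thesis
        using X by (simp add: set_lebesgue_integral_def measure_def emeasure_trace_measure[OF \<mu>])
    qed
    have "(LINT x:X|?T. M x) \<bullet> b = (LINT x:X|?T. M x \<bullet> b)"
      unfolding set_lebesgue_integral_def
      by (subst integral_inner_left[symmetric])
        (use intM X in \<open>auto intro!: integrable_mult_indicator\<close>)
    also have "\<dots> = (LINT x:X|?T. h b x - 1)"
      using b by (simp add: M_def inner_sum_left inner_Basis if_distrib cong: if_cong)
    also have "\<dots> = (LINT x:X|?T. h b x) - (LINT x:X|?T. 1)"
    proof (rule set_integral_diff)
      show "set_integrable ?T X (h b)" "set_integrable ?T X (\<lambda>x. 1 :: real)"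
        unfolding set_integrable_def
        by (rule integrable_mult_indicator; use h(1)[OF b] X in simp)+
    qed
    also have "\<dots> = \<mu> X \<bullet> b" using h(2)[OF b X] tr by simp
    finally show "\<mu> X \<bullet> b = (LINT x:X|?T. M x) \<bullet> b" by simp
  qed
  ultimately show ?thesis unfolding is_trace_density_def by blast
qed

lemma is_trace_density_trace_density:
  "matrix_measure \<mu> \<Longrightarrow> is_trace_density \<mu> (trace_density \<mu>)"
  unfolding trace_density_def using trace_density_exists by (rule someI_ex)

lemma trace_density_unique:
  assumes "matrix_measure \<mu>" "is_trace_density \<mu> M" "is_trace_density \<mu> M'"
  shows "AE x in trace_measure \<mu>. M x = M' x"
proof -
  interpret finite_measure "trace_measure \<mu>" by (rule finite_trace_measure[OF assms(1)])
  show ?thesis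
    by (rule density_unique_banach) (use assms in \<open>auto simp: is_trace_density_def\<close>)
qed

end

theory Submission
  imports Defs "HOL-Real_Asymp.Real_Asymp"
begin

text \<open>
  Determinant and capacity are linked by the scalar monic polynomials \<open>q\<close> of degree \<open>n\<close>, measured
  by their supremum on the support \<open>E\<close>.

  \<^bold>\<open>Determinant.\<close> Let \<open>P n\<close> be the orthonormal polynomials. The matrix \<open>C = \<langle>P n, x\<^sup>n\<rangle>\<close> is the adjoint of
  \<open>A 1 ** \<dots> ** A n\<close> (lemma \<open>monomial_coeff_eq_adj_prod\<close>), and orthogonality to lower degrees gives \<open>C = \<langle>P n, q\<rangle>\<close> for
  every monic \<open>q\<close>. Bessel's inequality then bounds the sum of the squared entries of \<open>C\<close> by the trace of
  \<open>\<langle>q, q\<rangle>\<close>, which is at most \<open>l\<close> times the square of the supremum \<open>s\<close> of \<open>\<bar>q\<bar>\<close> on \<open>E\<close>. The Leibniz formula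
  yields \<open>\<bar>det C\<bar> \<le> K * s ^ l\<close> with \<open>K\<close> independent of \<open>n\<close>; the \<open>n\<close>-th root removes this constant.

  \<^bold>\<open>Potential theory.\<close> For every \<open>c\<close> above the capacity there are, for all large \<open>n\<close>, monic polynomials of degree
  \<open>n\<close> bounded by \<open>c ^ n\<close> on \<open>E\<close> (lemma \<open>monic_poly_small_on_compact\<close>). Otherwise, for infinitely many \<open>n\<close>, each of
  \<open>n + 1\<close> Fekete points has product of distances at least \<open>c ^ n\<close> to the others. The uniform measures on
  these points have asymptotic logarithmic energy at most \<open>- ln c\<close>; by lower semicontinuity of the energy,
  so does a weak limit of them, which is a probability measure on \<open>E\<close>. This makes the capacity at least \<open>c\<close>.

  Combining both, the upper limit is at most \<open>c ^ l\<close> for all \<open>c\<close> above the capacity.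
\<close>

section \<open>Fekete points\<close>

text \<open>For real points, the square of their Vandermonde determinant: each pair occurs in both orders.\<close>

definition pair_prod :: "'i set \<Rightarrow> ('i \<Rightarrow> real) \<Rightarrow> real" where
  "pair_prod N z = (\<Prod>j\<in>N. \<Prod>i\<in>N - {j}. \<bar>z j - z i\<bar>)"

text \<open>Moving only the point with index \<open>k\<close> leaves the second factor alone.\<close>

lemma pair_prod_split:
  assumes "finite N" "k \<in> N"
  shows "pair_prod N z = (\<Prod>i\<in>N - {k}. \<bar>z k - z i\<bar>)\<^sup>2 * pair_prod (N - {k}) z"
proof -
  have "(\<Prod>i\<in>N - {j}. \<bar>z j - z i\<bar>) = \<bar>z k - z j\<bar> * (\<Prod>i\<in>N - {k} - {j}. \<bar>z j - z i\<bar>)"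
    if "j \<in> N - {k}" for j
  proof -
    have "N - {j} - {k} = N - {k} - {j}" by auto
    then show ?thesis
      using assms that by (subst prod.remove[of _ k]) (auto simp: abs_minus_commute)
  qed
  then have "(\<Prod>j\<in>N - {k}. \<Prod>i\<in>N - {j}. \<bar>z j - z i\<bar>)
      = (\<Prod>j\<in>N - {k}. \<bar>z k - z j\<bar>) * pair_prod (N - {k}) z"
    by (simp add: pair_prod_def prod.distrib)
  then show ?thesis
    unfolding pair_prod_def[of N] using assms
    by (subst prod.remove[of _ k]) (auto simp: power2_eq_square)
qed

text \<open>Points that maximise the product of all mutual distances (Fekete points): when all but one of
  them are held fixed, the remaining one maximises its product of distances to the others. The set
  is infinite so that the maximal product is positive and the common factor can be cancelled.\<close>

lemma fekete_points_exist:
  fixes E :: "real set"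
  assumes "compact E" "infinite E"
  obtains z :: "nat \<Rightarrow> real" where "\<And>i. z i \<in> E"
    "\<And>k x. k \<le> n \<Longrightarrow> x \<in> E \<Longrightarrow>
      (\<Prod>i\<in>{..n} - {k}. \<bar>x - z i\<bar>) \<le> (\<Prod>i\<in>{..n} - {k}. \<bar>z k - z i\<bar>)"
proof -
  define K where "K = PiE (UNIV :: nat set) (\<lambda>_. E)"
  have "compactin (product_topology (\<lambda>i. euclidean) UNIV) K"
    unfolding K_def using assms(1) by (subst compactin_PiE) auto
  then have "compact K"
    by (simp add: euclidean_product_topology)
  obtain w :: "nat \<Rightarrow> real" where w: "inj w" "range w \<subseteq> E"
    using infinite_countable_subset[OF assms(2)] by blast
  have wK: "w \<in> K" using w(2) by (auto simp: K_def)
  have "continuous_on K (pair_prod {..n})"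
    unfolding pair_prod_def
    by (intro continuous_intros continuous_on_subset[OF continuous_on_product_coordinates]) auto
  then obtain z where z: "z \<in> K" "\<And>y. y \<in> K \<Longrightarrow> pair_prod {..n} y \<le> pair_prod {..n} z"
    using continuous_attains_sup[OF \<open>compact K\<close>] wK by blast
  have "0 < pair_prod {..n} w"
    unfolding pair_prod_def using w(1) by (intro prod_pos) (auto dest: injD)
  then have pos: "0 < pair_prod {..n} z"
    using z(2)[OF wK] by simp
  show thesis
  proof
    show zE: "z i \<in> E" for i using z(1) by (auto simp: K_def)
    fix k x assume k: "k \<le> n" and x: "x \<in> E"
    let ?R = "pair_prod ({..n} - {k})"
    have R: "0 < ?R z"
    proof -
      have "?R z \<noteq> 0"
        using pos k by (subst (asm) pair_prod_split[of _ k]) auto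
      moreover have "0 \<le> ?R z"
        unfolding pair_prod_def by (intro prod_nonneg) auto
      ultimately show ?thesis by simp
    qed
    have "z(k := x) \<in> K" using zE x by (auto simp: K_def)
    from z(2)[OF this]
    have "(\<Prod>i\<in>{..n} - {k}. \<bar>(z(k:=x)) k - (z(k:=x)) i\<bar>)\<^sup>2 * ?R (z(k:=x))
        \<le> (\<Prod>i\<in>{..n} - {k}. \<bar>z k - z i\<bar>)\<^sup>2 * ?R z"
      using k by (simp add: pair_prod_split[of "{..n}" k] del: fun_upd_apply)
    also have "?R (z(k:=x)) = ?R z"
      unfolding pair_prod_def by (intro prod.cong) auto
    also have "(\<Prod>i\<in>{..n} - {k}. \<bar>(z(k:=x)) k - (z(k:=x)) i\<bar>) = (\<Prod>i\<in>{..n} - {k}. \<bar>x - z i\<bar>)"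
      by (intro prod.cong) auto
    finally have "(\<Prod>i\<in>{..n} - {k}. \<bar>x - z i\<bar>)\<^sup>2 \<le> (\<Prod>i\<in>{..n} - {k}. \<bar>z k - z i\<bar>)\<^sup>2"
      using R by simp
    then show "(\<Prod>i\<in>{..n} - {k}. \<bar>x - z i\<bar>) \<le> (\<Prod>i\<in>{..n} - {k}. \<bar>z k - z i\<bar>)"
      by (rule power2_le_imp_le) (intro prod_nonneg, auto)
  qed
qed

text \<open>If every monic polynomial of degree \<open>n\<close> exceeds \<open>c ^ n\<close> somewhere on \<open>E\<close>, this holds in
  particular for the polynomial that vanishes at all but one of \<open>n + 1\<close> Fekete points. That polynomial
  is largest at the omitted point, so each Fekete point is far from the others on geometric average.\<close>

lemma spread_points_if_monic_polys_large:
  fixes E :: "real set" and n :: nat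
  assumes E: "compact E" "infinite E" and c: "0 < c"
    and large: "\<And>Q :: real poly. degree Q = n \<Longrightarrow> lead_coeff Q = 1 \<Longrightarrow> \<exists>x\<in>E. c ^ n < \<bar>poly Q x\<bar>"
  obtains z :: "nat \<Rightarrow> real" where "\<And>i. z i \<in> E"
    "\<And>k. k \<le> n \<Longrightarrow> c ^ n \<le> (\<Prod>i\<in>{..n} - {k}. \<bar>z k - z i\<bar>)"
proof -
  obtain z :: "nat \<Rightarrow> real" where z: "\<And>i. z i \<in> E"
    "\<And>k x. k \<le> n \<Longrightarrow> x \<in> E \<Longrightarrow>
      (\<Prod>i\<in>{..n} - {k}. \<bar>x - z i\<bar>) \<le> (\<Prod>i\<in>{..n} - {k}. \<bar>z k - z i\<bar>)"
    using fekete_points_exist[OF E] by metis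
  show thesis
  proof (rule that[of z])
    show "z i \<in> E" for i by (rule z)
    fix k assume k: "k \<le> n"
    let ?Q = "\<Prod>i\<in>{..n} - {k}. [:- z i, 1:]"
    have "degree ?Q = n"
      using k by (subst degree_prod_eq_sum_degree) auto
    moreover have "lead_coeff ?Q = 1"
      by (subst lead_coeff_prod) auto
    ultimately obtain x where x: "x \<in> E" "c ^ n < \<bar>poly ?Q x\<bar>"
      using large by blast
    have "\<bar>poly ?Q x\<bar> = (\<Prod>i\<in>{..n} - {k}. \<bar>x - z i\<bar>)"
      by (simp add: poly_prod abs_prod)
    then show "c ^ n \<le> (\<Prod>i\<in>{..n} - {k}. \<bar>z k - z i\<bar>)"
      using x z(2)[OF k x(1)] by simp
  qed
qed

section \<open>Logarithmic energy\<close>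

text \<open>The logarithmic kernel plus \<open>ln D\<close>. It is non-negative at points of distance at most \<open>D\<close>, so its
  integrals exist in \<open>ennreal\<close> and Fatou's lemma applies to them.\<close>

definition shifted_kernel :: "real \<Rightarrow> real \<Rightarrow> real \<Rightarrow> ennreal" where
  "shifted_kernel D x y = (if x = y then \<infinity> else ennreal (ln D - ln \<bar>x - y\<bar>))"

lemma log_kernel_measurable [measurable]:
  "(\<lambda>(x, y). log_kernel x y) \<in> borel_measurable (borel \<Otimes>\<^sub>M borel)"
  unfolding log_kernel_def by measurable

lemma shifted_kernel_measurable [measurable]:
  "(\<lambda>(x, y). shifted_kernel D x y) \<in> borel_measurable (borel \<Otimes>\<^sub>M borel)"
  unfolding shifted_kernel_def by measurable

text \<open>Positive and negative part of the kernel are integrated separately in the definition of the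
  energy. The negative part is at most \<open>ln D\<close>, hence has a finite integral, and
  \<open>k\<^sup>+ + ln D = (k + ln D) + k\<^sup>-\<close> turns the difference of two integrals into a single one.\<close>

lemma log_energy_eq_shifted:
  fixes \<nu> :: "real measure"
  assumes \<nu>: "prob_space \<nu>" "sets \<nu> = sets borel" "emeasure \<nu> E = 1" "E \<in> sets borel"
    and D: "1 \<le> D" "\<And>x y. x \<in> E \<Longrightarrow> y \<in> E \<Longrightarrow> \<bar>x - y\<bar> \<le> D"
  shows "log_energy \<nu> = enn2ereal (\<integral>\<^sup>+x. \<integral>\<^sup>+y. shifted_kernel D x y \<partial>\<nu> \<partial>\<nu>) - ereal (ln D)"
proof -
  interpret prob_space \<nu> by fact
  note \<nu>(2)[measurable_cong]
  have AEE: "AE x in \<nu>. x \<in> E"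
    using \<nu> by (intro AE_prob_1) (simp add: measure_def)
  define P where "P = (\<integral>\<^sup>+x. \<integral>\<^sup>+y. e2ennreal (log_kernel x y) \<partial>\<nu> \<partial>\<nu>)"
  define Q where "Q = (\<integral>\<^sup>+x. \<integral>\<^sup>+y. e2ennreal (- log_kernel x y) \<partial>\<nu> \<partial>\<nu>)"
  define G where "G = (\<integral>\<^sup>+x. \<integral>\<^sup>+y. shifted_kernel D x y \<partial>\<nu> \<partial>\<nu>)"
  have lnD: "0 \<le> ln D" using D(1) by simp
  have pt: "e2ennreal (log_kernel x y) + ennreal (ln D)
      = shifted_kernel D x y + e2ennreal (- log_kernel x y)"
    and ptQ: "e2ennreal (- log_kernel x y) \<le> ennreal (ln D)" if "x \<in> E" "y \<in> E" for x y
  proof -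
    have le: "ln \<bar>x - y\<bar> \<le> ln D" if "x \<noteq> y"
      using D(2)[OF \<open>x \<in> E\<close> \<open>y \<in> E\<close>] D(1) that by (intro ln_mono) auto
    show "e2ennreal (log_kernel x y) + ennreal (ln D)
      = shifted_kernel D x y + e2ennreal (- log_kernel x y)"
    proof (cases "x = y")
      case True
      then show ?thesis by (simp add: log_kernel_def shifted_kernel_def)
    next
      case False
      have "ennreal (- L) + ennreal (ln D) = ennreal (ln D - L) + ennreal L" if "L \<le> ln D" for L
        using that lnD
        by (cases "0 \<le> L") (auto simp: ennreal_neg simp flip: ennreal_plus)
      with False le show ?thesis
        by (simp add: log_kernel_def shifted_kernel_def)
    qed
    show "e2ennreal (- log_kernel x y) \<le> ennreal (ln D)"
      using le by (auto simp: log_kernel_def e2ennreal_neg intro: ennreal_leI)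
  qed
  have "P + ennreal (ln D) = (\<integral>\<^sup>+x. \<integral>\<^sup>+y. e2ennreal (log_kernel x y) + ennreal (ln D) \<partial>\<nu> \<partial>\<nu>)"
    unfolding P_def by (simp add: nn_integral_add emeasure_space_1)
  also have "\<dots> = (\<integral>\<^sup>+x. \<integral>\<^sup>+y. shifted_kernel D x y + e2ennreal (- log_kernel x y) \<partial>\<nu> \<partial>\<nu>)"
  proof (rule nn_integral_cong_AE)
    from AEE show "AE x in \<nu>. (\<integral>\<^sup>+y. e2ennreal (log_kernel x y) + ennreal (ln D) \<partial>\<nu>)
        = (\<integral>\<^sup>+y. shifted_kernel D x y + e2ennreal (- log_kernel x y) \<partial>\<nu>)"
    proof eventually_elim
      case (elim x)
      show ?case
        by (rule nn_integral_cong_AE) (use AEE in eventually_elim, use elim pt in blast)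
    qed
  qed
  also have "\<dots> = G + Q"
    unfolding G_def Q_def by (simp add: nn_integral_add)
  finally have eq: "P + ennreal (ln D) = G + Q" .
  have "Q \<le> (\<integral>\<^sup>+x. \<integral>\<^sup>+y. ennreal (ln D) \<partial>\<nu> \<partial>\<nu>)"
    unfolding Q_def
  proof (rule nn_integral_mono_AE)
    from AEE show "AE x in \<nu>. (\<integral>\<^sup>+y. e2ennreal (- log_kernel x y) \<partial>\<nu>) \<le> (\<integral>\<^sup>+y. ennreal (ln D) \<partial>\<nu>)"
    proof eventually_elim
      case (elim x)
      show ?case
        by (rule nn_integral_mono_AE) (use AEE in eventually_elim, use elim ptQ in blast)
    qed
  qed
  then have "Q \<le> ennreal (ln D)" by (simp add: emeasure_space_1)
  then obtain q where q: "Q = ennreal q" "0 \<le> q"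
    by (cases Q) (auto simp: top_unique)
  have "enn2ereal P - enn2ereal Q = enn2ereal G - ereal (ln D)"
  proof (cases P)
    case (real p)
    with eq q lnD obtain g where g: "G = ennreal g" "0 \<le> g"
      by (cases G) (auto simp flip: ennreal_plus)
    have "p + ln D = g + q"
      using eq real q g lnD by (simp flip: ennreal_plus)
    then show ?thesis using real q g by simp
  next
    case top
    with eq q have "G = top" by (cases G) (auto simp flip: ennreal_plus)
    with top q show ?thesis by simp
  qed
  then show ?thesis
    by (simp add: log_energy_def P_def Q_def G_def)
qed

text \<open>The shifted kernel with distances below \<open>e\<close> replaced by \<open>e\<close>: finite on the diagonal, so that
  measures with atoms have finite energy with respect to it.\<close>

definition cut_kernel :: "real \<Rightarrow> real \<Rightarrow> real \<Rightarrow> real \<Rightarrow> real" where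
  "cut_kernel D e x y = ln D - ln (max \<bar>x - y\<bar> e)"

lemma cut_kernel_measurable [measurable]:
  "(\<lambda>(x, y). cut_kernel D e x y) \<in> borel_measurable (borel \<Otimes>\<^sub>M borel)"
  unfolding cut_kernel_def by measurable

text \<open>The cut-off may shrink while the arguments move: if the limits of the arguments coincide, the
  truncated distances tend to \<open>0\<close> and the kernel to \<open>\<infinity>\<close>, as it should.\<close>

lemma cut_kernel_tendsto_shifted_kernel:
  fixes a b e :: "nat \<Rightarrow> real"
  assumes a: "a \<longlonglongrightarrow> x" and b: "b \<longlonglongrightarrow> y" and e: "e \<longlonglongrightarrow> 0" "\<And>j. 0 < e j"
  shows "(\<lambda>j. ennreal (cut_kernel D (e j) (a j) (b j))) \<longlonglongrightarrow> shifted_kernel D x y"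
proof -
  let ?m = "\<lambda>j. max \<bar>a j - b j\<bar> (e j)"
  have m: "?m \<longlonglongrightarrow> max \<bar>x - y\<bar> 0"
    by (intro tendsto_intros a b e)
  show ?thesis
  proof (cases "x = y")
    case True
    with m have "?m \<longlonglongrightarrow> 0" by simp
    moreover have "\<forall>\<^sub>F j in sequentially. ?m j \<in> {0<..}"
      using e(2) by (auto simp: less_max_iff_disj)
    ultimately have "filterlim ?m (at_right 0) sequentially"
      by (auto simp: filterlim_at elim: eventually_mono)
    then have "filterlim (\<lambda>j. ln (?m j)) at_bot sequentially"
      by (rule filterlim_compose[OF ln_at_0])
    then have "filterlim (\<lambda>j. - ln (?m j)) at_top sequentially"
      by (simp add: filterlim_uminus_at_top)
    then have "filterlim (\<lambda>j. ln D + - ln (?m j)) at_top sequentially"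
      by (rule filterlim_tendsto_add_at_top[OF tendsto_const])
    then show ?thesis
      using True by (simp add: shifted_kernel_def cut_kernel_def ennreal_tendsto_top_eq_at_top)
  next
    case False
    have "(\<lambda>j. ln D - ln (?m j)) \<longlonglongrightarrow> ln D - ln (max \<bar>x - y\<bar> 0)"
      using False by (intro tendsto_intros m) auto
    then show ?thesis
      using False unfolding shifted_kernel_def cut_kernel_def
      by (auto intro: tendsto_ennrealI)
  qed
qed

text \<open>Measures carried by a compact set are tight, so a subsequence converges weakly; Skorohod's
  theorem realises it by random variables that converge pointwise. This form of weak convergence
  passes to the product measure at no cost, as double integrals are taken over the same space.\<close>

lemma weak_limit_on_compact:
  fixes E :: "real set" and \<rho> :: "nat \<Rightarrow> real measure"
  assumes E: "compact E"
    and \<rho>: "\<And>j. real_distribution (\<rho> j)" "\<And>j. emeasure (\<rho> j) E = 1"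
  obtains r \<Omega> and X :: "nat \<Rightarrow> real \<Rightarrow> real" and Y :: "real \<Rightarrow> real"
  where "strict_mono (r :: nat \<Rightarrow> nat)" "prob_space (\<Omega> :: real measure)"
    "\<And>j. X j \<in> borel_measurable \<Omega>" "Y \<in> borel_measurable \<Omega>"
    "\<And>j. distr \<Omega> borel (X j) = \<rho> (r j)" "\<And>\<omega>. \<omega> \<in> space \<Omega> \<Longrightarrow> (\<lambda>j. X j \<omega>) \<longlonglongrightarrow> Y \<omega>"
    "emeasure (distr \<Omega> borel Y) E = 1"
proof -
  have Eb: "E \<in> sets borel" by (rule borel_closed[OF compact_imp_closed[OF E]])
  obtain R where R: "\<And>x. x \<in> E \<Longrightarrow> \<bar>x\<bar> \<le> R" "0 < R"
    using compact_imp_bounded[OF E] by (auto simp: bounded_pos)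
  have "tight \<rho>"
    unfolding tight_def
  proof (intro conjI allI impI exI)
    show "real_distribution (\<rho> j)" for j by fact
    \<comment> \<open>The interval \<open>{- R - 1<..R}\<close> is open on the left, so it has to start strictly below \<open>- R\<close>.\<close>
    show "- R - 1 < R" using R by simp
    fix \<epsilon> :: real and j assume "0 < \<epsilon>"
    interpret real_distribution "\<rho> j" by fact
    have "measure (\<rho> j) E \<le> measure (\<rho> j) {- R - 1<..R}"
      by (rule finite_measure_mono) (use R(1) in force)+
    moreover have "measure (\<rho> j) E = 1" using \<rho>(2)[of j] by (simp add: measure_def)
    ultimately show "1 - \<epsilon> < measure (\<rho> j) {- R - 1<..R}" using \<open>0 < \<epsilon>\<close> by simp
  qed
  then obtain r M where r: "strict_mono r" "real_distribution M" "weak_conv_m (\<rho> \<circ> id \<circ> r) M"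
    using tight_imp_convergent_subsubsequence[of \<rho> id] by (auto simp: strict_mono_id)
  then obtain \<Omega> :: "real measure" and X :: "nat \<Rightarrow> real \<Rightarrow> real" and Y :: "real \<Rightarrow> real"
    where S: "prob_space \<Omega>" "\<And>j. X j \<in> borel_measurable \<Omega>"
      "\<And>j. distr \<Omega> borel (X j) = \<rho> (r j)" "Y \<in> borel_measurable \<Omega>"
      "\<And>\<omega>. \<omega> \<in> space \<Omega> \<Longrightarrow> (\<lambda>j. X j \<omega>) \<longlonglongrightarrow> Y \<omega>"
    using Skorohod[OF _ r(2,3)] \<rho>(1) by simp metis
  interpret prob_space \<Omega> by fact
  have "AE \<omega> in \<Omega>. X j \<omega> \<in> E" for j
  proof -
    have "prob (X j -` E \<inter> space \<Omega>) = 1"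
      using \<rho>(2)[of "r j"] S(2)[of j] Eb
      by (simp add: S(3)[symmetric] emeasure_distr measure_def)
    then show ?thesis by (auto dest!: AE_prob_1)
  qed
  then have "AE \<omega> in \<Omega>. \<forall>j. X j \<omega> \<in> E" by (simp add: AE_all_countable)
  then have "AE \<omega> in \<Omega>. Y \<omega> \<in> E"
    using AE_space
  proof eventually_elim
    case (elim \<omega>)
    show ?case
    proof (rule closed_sequentially[OF compact_imp_closed[OF E]])
      show "X j \<omega> \<in> E" for j using elim by blast
      show "(\<lambda>j. X j \<omega>) \<longlonglongrightarrow> Y \<omega>" using elim by (intro S(5))
    qed
  qed
  then have "emeasure \<Omega> (Y -` E \<inter> space \<Omega>) = 1"
    using S(4) Eb by (intro emeasure_eq_1_AE) auto
  then have "emeasure (distr \<Omega> borel Y) E = 1"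
    using S(4) Eb by (simp add: emeasure_distr)
  with r(1) S show thesis by (intro that)
qed

text \<open>Lower semicontinuity of the energy, by Fatou's lemma for both integrals. Letting the cut-off
  shrink along the sequence avoids a second limit, over fixed truncations of the kernel.\<close>

lemma shifted_energy_lower_semicontinuous:
  fixes \<rho> :: "nat \<Rightarrow> real measure" and e b :: "nat \<Rightarrow> real"
  assumes E: "compact E"
    and \<rho>: "\<And>j. real_distribution (\<rho> j)" "\<And>j. emeasure (\<rho> j) E = 1"
    and e: "e \<longlonglongrightarrow> 0" "\<And>j. 0 < e j"
    and bound: "\<And>j. (\<integral>\<^sup>+x. \<integral>\<^sup>+y. ennreal (cut_kernel D (e j) x y) \<partial>\<rho> j \<partial>\<rho> j) \<le> ennreal (b j)"
    and b: "b \<longlonglongrightarrow> B"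
  obtains \<nu> where "prob_space \<nu>" "sets \<nu> = sets borel" "emeasure \<nu> E = 1"
    "(\<integral>\<^sup>+x. \<integral>\<^sup>+y. shifted_kernel D x y \<partial>\<nu> \<partial>\<nu>) \<le> ennreal B"
proof -
  obtain r \<Omega> X Y where r: "strict_mono (r :: nat \<Rightarrow> nat)"
    and \<Omega>: "prob_space (\<Omega> :: real measure)"
    and meas [measurable]: "\<And>j. X j \<in> borel_measurable \<Omega>" "Y \<in> borel_measurable \<Omega>"
    and distr: "\<And>j. distr \<Omega> borel (X j) = \<rho> (r j)"
    and lim: "\<And>\<omega>. \<omega> \<in> space \<Omega> \<Longrightarrow> (\<lambda>j. X j \<omega>) \<longlonglongrightarrow> Y \<omega>"
    and one: "emeasure (distr \<Omega> borel Y) E = 1"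
    by (rule weak_limit_on_compact[of E \<rho>, OF E \<rho>]) (rule that)
  interpret prob_space \<Omega> by fact
  define e' where "e' = e \<circ> r"
  have e': "e' \<longlonglongrightarrow> 0" "\<And>j. 0 < e' j"
    using LIMSEQ_subseq_LIMSEQ[OF e(1) r] e(2) by (auto simp: e'_def)
  let ?k = "\<lambda>j \<omega> \<omega>'. ennreal (cut_kernel D (e' j) (X j \<omega>) (X j \<omega>'))"
  have "(\<integral>\<^sup>+\<omega>. \<integral>\<^sup>+\<omega>'. shifted_kernel D (Y \<omega>) (Y \<omega>') \<partial>\<Omega> \<partial>\<Omega>)
      = (\<integral>\<^sup>+\<omega>. \<integral>\<^sup>+\<omega>'. liminf (\<lambda>j. ?k j \<omega> \<omega>') \<partial>\<Omega> \<partial>\<Omega>)"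
    by (intro nn_integral_cong lim_imp_Liminf[symmetric] cut_kernel_tendsto_shifted_kernel
        lim e') auto
  also have "\<dots> \<le> (\<integral>\<^sup>+\<omega>. liminf (\<lambda>j. \<integral>\<^sup>+\<omega>'. ?k j \<omega> \<omega>' \<partial>\<Omega>) \<partial>\<Omega>)"
    by (intro nn_integral_mono nn_integral_liminf) measurable
  also have "\<dots> \<le> liminf (\<lambda>j. \<integral>\<^sup>+\<omega>. \<integral>\<^sup>+\<omega>'. ?k j \<omega> \<omega>' \<partial>\<Omega> \<partial>\<Omega>)"
    by (intro nn_integral_liminf) measurable
  also have "\<dots> \<le> liminf (\<lambda>j. ennreal (b (r j)))"
  proof (intro Liminf_mono always_eventually allI)
    fix j
    interpret D: prob_space "distr \<Omega> borel (X j)" by (rule prob_space_distr) measurable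
    have "(\<integral>\<^sup>+\<omega>. \<integral>\<^sup>+\<omega>'. ?k j \<omega> \<omega>' \<partial>\<Omega> \<partial>\<Omega>)
        = (\<integral>\<^sup>+x. \<integral>\<^sup>+y. ennreal (cut_kernel D (e' j) x y) \<partial>distr \<Omega> borel (X j) \<partial>distr \<Omega> borel (X j))"
      by (simp add: nn_integral_distr)
    also have "\<dots> \<le> ennreal (b (r j))"
      using bound[of "r j"] by (simp add: distr e'_def)
    finally show "(\<integral>\<^sup>+\<omega>. \<integral>\<^sup>+\<omega>'. ?k j \<omega> \<omega>' \<partial>\<Omega> \<partial>\<Omega>) \<le> ennreal (b (r j))" .
  qed
  also have "\<dots> = ennreal B"
    using LIMSEQ_subseq_LIMSEQ[OF b r]
    by (intro lim_imp_Liminf tendsto_ennrealI) (auto simp: comp_def)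
  finally have le: "(\<integral>\<^sup>+\<omega>. \<integral>\<^sup>+\<omega>'. shifted_kernel D (Y \<omega>) (Y \<omega>') \<partial>\<Omega> \<partial>\<Omega>) \<le> ennreal B" .
  interpret Y: prob_space "distr \<Omega> borel Y" by (rule prob_space_distr) measurable
  show thesis
  proof
    show "prob_space (distr \<Omega> borel Y)" by (rule Y.prob_space_axioms)
    show "(\<integral>\<^sup>+x. \<integral>\<^sup>+y. shifted_kernel D x y \<partial>distr \<Omega> borel Y \<partial>distr \<Omega> borel Y) \<le> ennreal B"
      using le by (simp add: nn_integral_distr)
  qed (use one in auto)
qed

text \<open>The energy of the uniform measure on \<open>n + 1\<close> points with large mutual distances. The cut-off
  \<open>1 / (n + 1)\<close> makes each of the \<open>n + 1\<close> diagonal terms of size \<open>ln (n + 1)\<close>, which is negligible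
  against the \<open>(n + 1)\<^sup>2\<close> terms in the average.\<close>

lemma discrete_energy_bound:
  fixes z :: "nat \<Rightarrow> real"
  assumes z: "\<And>i. z i \<in> E" and D: "1 \<le> D" "\<And>x y. x \<in> E \<Longrightarrow> y \<in> E \<Longrightarrow> \<bar>x - y\<bar> \<le> D"
    and c: "0 < c" and prod: "\<And>k. k \<le> n \<Longrightarrow> c ^ n \<le> (\<Prod>i\<in>{..n} - {k}. \<bar>z k - z i\<bar>)"
  defines "\<rho> \<equiv> distr (measure_pmf (pmf_of_set {..n})) borel z"
  shows "(\<integral>\<^sup>+x. \<integral>\<^sup>+y. ennreal (cut_kernel D (1 / real (Suc n)) x y) \<partial>\<rho> \<partial>\<rho>)
    \<le> ennreal (ln D + ln (real (Suc n)) / real (Suc n) - real n / real (Suc n) * ln c)"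
proof -
  let ?e = "1 / real (Suc n)"
  let ?b = "ln D + ln (real (Suc n)) / real (Suc n) - real n / real (Suc n) * ln c"
  interpret prob_space \<rho>
    unfolding \<rho>_def by (intro measure_pmf.prob_space_distr) auto
  have sets [measurable_cong]: "sets \<rho> = sets borel" by (simp add: \<rho>_def)
  have pos: "0 \<le> cut_kernel D ?e x y" if "x \<in> E" "y \<in> E" for x y
  proof -
    have "?e \<le> 1" by simp
    with D(1) have "?e \<le> D" by (rule order_trans[rotated])
    then have "max \<bar>x - y\<bar> ?e \<le> D"
      using D(2)[OF that] by (rule max.boundedI[rotated])
    then have "ln (max \<bar>x - y\<bar> ?e) \<le> ln D"
      by (intro ln_mono) (auto simp: less_max_iff_disj)
    then show ?thesis by (simp add: cut_kernel_def)
  qed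
  have inner: "(\<integral>\<^sup>+y. ennreal (cut_kernel D ?e (z k) y) \<partial>\<rho>) \<le> ennreal ?b" if k: "k \<le> n" for k
  proof -
    have P: "0 < (\<Prod>i\<in>{..n} - {k}. \<bar>z k - z i\<bar>)"
      using prod[OF k] c by (meson less_le_trans zero_less_power)
    have ne: "z k \<noteq> z i" if "i \<in> {..n} - {k}" for i
    proof
      assume "z k = z i"
      then have "(\<Prod>i\<in>{..n} - {k}. \<bar>z k - z i\<bar>) = 0"
        using that by (intro prod_zero) auto
      with P show False by simp
    qed
    have "(\<Sum>i\<le>n. cut_kernel D ?e (z k) (z i))
        = cut_kernel D ?e (z k) (z k) + (\<Sum>i\<in>{..n} - {k}. cut_kernel D ?e (z k) (z i))"
      using k by (subst sum.remove[of _ k]) auto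
    also have "cut_kernel D ?e (z k) (z k) = ln D + ln (real (Suc n))"
      by (simp add: cut_kernel_def ln_div)
    also have "(\<Sum>i\<in>{..n} - {k}. cut_kernel D ?e (z k) (z i)) \<le> (\<Sum>i\<in>{..n} - {k}. ln D - ln \<bar>z k - z i\<bar>)"
      unfolding cut_kernel_def using ne by (intro sum_mono diff_left_mono ln_mono) auto
    also have "\<dots> = n * ln D - ln (\<Prod>i\<in>{..n} - {k}. \<bar>z k - z i\<bar>)"
      using ne k by (subst ln_prod) (auto simp: sum_subtractf)
    also have "\<dots> \<le> n * ln D - n * ln c"
      using ln_mono[OF prod[OF k]] c by (simp add: ln_realpow)
    finally have S: "(\<Sum>i\<le>n. cut_kernel D ?e (z k) (z i)) \<le> ln D + ln (real (Suc n)) + (n * ln D - n * ln c)"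
      by simp
    have "(\<integral>\<^sup>+y. ennreal (cut_kernel D ?e (z k) y) \<partial>\<rho>)
        = (\<Sum>i\<le>n. ennreal (cut_kernel D ?e (z k) (z i))) / of_nat (Suc n)"
      unfolding \<rho>_def by (subst nn_integral_distr) (auto simp: nn_integral_pmf_of_set)
    also have "\<dots> = ennreal ((\<Sum>i\<le>n. cut_kernel D ?e (z k) (z i)) / real (Suc n))"
      using pos[OF z z]
      by (simp add: sum_nonneg ennreal_of_nat_eq_real_of_nat divide_ennreal del: of_nat_Suc)
    also have "\<dots> \<le> ennreal ?b"
    proof (rule ennreal_leI)
      have "(\<Sum>i\<le>n. cut_kernel D ?e (z k) (z i)) / real (Suc n)
          \<le> (ln D + ln (real (Suc n)) + (n * ln D - n * ln c)) / real (Suc n)"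
        using S by (rule divide_right_mono) simp
      also have "ln D + ln (real (Suc n)) + (n * ln D - n * ln c)
          = ln D * real (Suc n) + ln (real (Suc n)) - n * ln c"
        by (simp add: algebra_simps)
      also have "\<dots> / real (Suc n) = ?b"
        by (simp add: add_divide_distrib diff_divide_distrib del: of_nat_Suc)
      finally show "(\<Sum>i\<le>n. cut_kernel D ?e (z k) (z i)) / real (Suc n) \<le> ?b" .
    qed
    finally show ?thesis .
  qed
  have "AE x in \<rho>. (\<integral>\<^sup>+y. ennreal (cut_kernel D ?e x y) \<partial>\<rho>) \<le> ennreal ?b"
  proof -
    have "AE k in measure_pmf (pmf_of_set {..n}).
        (\<integral>\<^sup>+y. ennreal (cut_kernel D ?e (z k) y) \<partial>\<rho>) \<le> ennreal ?b"
      using inner by (simp add: AE_measure_pmf_iff)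
    moreover have "(AE x in \<rho>. F x \<le> ennreal ?b)
        \<longleftrightarrow> (AE k in measure_pmf (pmf_of_set {..n}). F (z k) \<le> ennreal ?b)"
      if "F \<in> borel_measurable borel" for F
      unfolding \<rho>_def using that by (intro AE_distr_iff) measurable
    moreover have "(\<lambda>x. \<integral>\<^sup>+y. ennreal (cut_kernel D ?e x y) \<partial>\<rho>) \<in> borel_measurable borel"
      by measurable
    ultimately show ?thesis by blast
  qed
  then have "(\<integral>\<^sup>+x. \<integral>\<^sup>+y. ennreal (cut_kernel D ?e x y) \<partial>\<rho> \<partial>\<rho>) \<le> (\<integral>\<^sup>+x. ennreal ?b \<partial>\<rho>)"
    by (rule nn_integral_mono_AE)
  then show ?thesis by (simp add: emeasure_space_1)
qed

section \<open>Capacity and monic polynomials\<close>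

text \<open>A comparison of discrete and continuous energy: the uniform measures on the given points have
  asymptotic energy at most \<open>- ln c\<close>, hence so has a weak limit of them.\<close>

lemma le_log_capacity:
  fixes E :: "real set" and z :: "nat \<Rightarrow> nat \<Rightarrow> real" and n :: "nat \<Rightarrow> nat"
  assumes E: "compact E" and c: "0 < c" and n: "filterlim n at_top sequentially"
    and z: "\<And>j i. z j i \<in> E"
    and prod: "\<And>j k. k \<le> n j \<Longrightarrow> c ^ n j \<le> (\<Prod>i\<in>{..n j} - {k}. \<bar>z j k - z j i\<bar>)"
  shows "c \<le> log_capacity E"
proof -
  have Eb: "E \<in> sets borel" by (rule borel_closed[OF compact_imp_closed[OF E]])
  \<comment> \<open>With \<open>c \<le> D\<close> the limit \<open>ln D - ln c\<close> of the bounds is non-negative, so \<open>ennreal\<close> does not cut it off.\<close>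
  obtain D where D: "1 \<le> D" "c \<le> D" "\<And>x y. x \<in> E \<Longrightarrow> y \<in> E \<Longrightarrow> \<bar>x - y\<bar> \<le> D"
  proof
    let ?D = "max 1 (max c (diameter E))"
    show "1 \<le> ?D" "c \<le> ?D" by auto
    show "\<bar>x - y\<bar> \<le> ?D" if "x \<in> E" "y \<in> E" for x y
      using diameter_bounded_bound[OF compact_imp_bounded[OF E] that] by (simp add: dist_real_def)
  qed
  define \<rho> where "\<rho> j = distr (measure_pmf (pmf_of_set {..n j})) borel (z j)" for j
  define e where "e j = 1 / real (Suc (n j))" for j
  define b where "b j = ln D + ln (real (Suc (n j))) / real (Suc (n j))
      - real (n j) / real (Suc (n j)) * ln c" for j
  have "real_distribution (\<rho> j)" for j
    unfolding \<rho>_def by (intro prob_space.real_distribution_distr measure_pmf.prob_space_axioms) auto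
  moreover have "emeasure (\<rho> j) E = 1" for j
  proof -
    have "z j -` E = UNIV" using z by auto
    then show ?thesis
      unfolding \<rho>_def using Eb by (subst emeasure_distr) (auto simp: measure_pmf.emeasure_space_1[simplified])
  qed
  moreover have "e \<longlonglongrightarrow> 0" unfolding e_def
    by (rule filterlim_compose[OF _ n]) real_asymp
  moreover have "0 < e j" for j by (simp add: e_def)
  moreover have "(\<integral>\<^sup>+x. \<integral>\<^sup>+y. ennreal (cut_kernel D (e j) x y) \<partial>\<rho> j \<partial>\<rho> j) \<le> ennreal (b j)" for j
    unfolding \<rho>_def e_def b_def by (rule discrete_energy_bound[OF z D(1,3) c prod])
  moreover have "b \<longlonglongrightarrow> ln D - ln c" unfolding b_def
    by (rule filterlim_compose[OF _ n]) real_asymp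
  ultimately obtain \<nu> where \<nu>: "prob_space \<nu>" "sets \<nu> = sets borel" "emeasure \<nu> E = 1"
    "(\<integral>\<^sup>+x. \<integral>\<^sup>+y. shifted_kernel D x y \<partial>\<nu> \<partial>\<nu>) \<le> ennreal (ln D - ln c)"
    using shifted_energy_lower_semicontinuous[OF E] by metis
  have "enn2ereal (\<integral>\<^sup>+x. \<integral>\<^sup>+y. shifted_kernel D x y \<partial>\<nu> \<partial>\<nu>) \<le> ereal (ln D - ln c)"
  proof -
    have "ln c \<le> ln D" using D(2) c by (intro ln_mono) auto
    then show ?thesis using \<nu>(4) by (simp add: less_eq_ennreal.rep_eq)
  qed
  then have "log_energy \<nu> \<le> ereal (ln D - ln c) - ereal (ln D)"
    by (subst log_energy_eq_shifted[OF \<nu>(1-3) Eb D(1,3)]) (assumption | rule ereal_minus_mono[OF _ order_refl])+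
  then have le: "log_energy \<nu> \<le> ereal (- ln c)" by simp
  let ?S = "{\<rho>. prob_space \<rho> \<and> sets \<rho> = sets borel \<and> emeasure \<rho> E = 1}"
  define V where "V = (INF \<rho>\<in>?S. log_energy \<rho>)"
  have "V \<le> log_energy \<nu>"
    unfolding V_def using \<nu> by (intro INF_lower) auto
  with le have up: "V \<le> ereal (- ln c)" by simp
  \<comment> \<open>Excludes \<open>V = - \<infinity>\<close>, for which \<open>real_of_ereal\<close> would return its default value \<open>0\<close>.\<close>
  have "ereal (- ln D) \<le> V"
    unfolding V_def
  proof (rule INF_greatest)
    fix \<rho> assume "\<rho> \<in> ?S"
    then have "log_energy \<rho> = enn2ereal (\<integral>\<^sup>+x. \<integral>\<^sup>+y. shifted_kernel D x y \<partial>\<rho> \<partial>\<rho>) - ereal (ln D)"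
      by (intro log_energy_eq_shifted[OF _ _ _ Eb D(1,3)]) auto
    moreover have "0 - ereal (ln D)
        \<le> enn2ereal (\<integral>\<^sup>+x. \<integral>\<^sup>+y. shifted_kernel D x y \<partial>\<rho> \<partial>\<rho>) - ereal (ln D)"
      by (intro ereal_minus_mono) auto
    ultimately show "ereal (- ln D) \<le> log_energy \<rho>" by simp
  qed
  with up obtain v where v: "V = ereal v" "v \<le> - ln c"
    by (cases V) auto
  have "c = exp (ln c)" using c by simp
  also have "\<dots> \<le> exp (- v)" using v by simp
  also have "\<dots> = log_capacity E"
    using v by (simp add: log_capacity_def V_def[symmetric])
  finally show ?thesis .
qed

lemma log_capacity_nonneg: "0 \<le> log_capacity E"
  by (simp add: log_capacity_def Let_def)

text \<open>The upper bound for Chebyshev polynomials: the supremum norms of suitable monic polynomials of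
  degree \<open>n\<close> grow at most like the \<open>n\<close>-th powers of any number above the capacity. If this failed
  for infinitely many \<open>n\<close>, Fekete points for these degrees would show that \<open>c\<close> is at most the capacity.\<close>

lemma monic_poly_small_on_compact:
  fixes E :: "real set"
  assumes E: "compact E" and c: "log_capacity E < c"
  shows "\<forall>\<^sub>F n in sequentially. \<exists>Q :: real poly. degree Q = n \<and> lead_coeff Q = 1 \<and>
    (\<forall>x\<in>E. \<bar>poly Q x\<bar> \<le> c ^ n)"
proof (cases "finite E")
  case True
  have "0 < c" using c log_capacity_nonneg[of E] by simp
  have "\<exists>Q :: real poly. degree Q = n \<and> lead_coeff Q = 1 \<and> (\<forall>x\<in>E. \<bar>poly Q x\<bar> \<le> c ^ n)"
    if "card E \<le> n" for n
  proof (intro exI conjI ballI)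
    \<comment> \<open>A finite set carries a monic polynomial that vanishes on it, padded with a power of the variable.\<close>
    let ?P = "\<Prod>a\<in>E. [:- a, 1:]" and ?Q = "(\<Prod>a\<in>E. [:- a, 1:]) * monom 1 (n - card E)"
    have "lead_coeff ?P = 1" by (subst lead_coeff_prod) auto
    moreover have "degree ?P = card E" by (subst degree_prod_eq_sum_degree) auto
    ultimately show "degree ?Q = n" "lead_coeff ?Q = 1"
      using that lead_coeff_mult[of ?P "monom 1 (n - card E)"]
      by (auto simp: degree_monom_eq degree_mult_eq simp del: coeff_mult simp flip: leading_coeff_0_iff)
    show "\<bar>poly ?Q x\<bar> \<le> c ^ n" if "x \<in> E" for x
    proof -
      have "poly ?P x = 0" using True that by (auto simp: poly_prod)
      then show ?thesis using \<open>0 < c\<close> by simp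
    qed
  qed
  then show ?thesis
    using eventually_sequentially by blast
next
  case False
  show ?thesis
  proof (rule ccontr)
    let ?bad = "\<lambda>n. \<forall>Q :: real poly. degree Q = n \<longrightarrow> lead_coeff Q = 1 \<longrightarrow> (\<exists>x\<in>E. c ^ n < \<bar>poly Q x\<bar>)"
    assume "\<not> ?thesis"
    then have "\<exists>\<^sub>F n in sequentially. ?bad n"
      unfolding not_eventually by (rule frequently_elim1) (auto simp: not_le)
    then have "infinite {n. ?bad n}"
      by (simp add: frequently_cofinite flip: cofinite_eq_sequentially)
    then obtain n :: "nat \<Rightarrow> nat" where n: "strict_mono n" "\<And>j. ?bad (n j)"
      using infinite_enumerate[of "{n. ?bad n}"] by auto
    have c0: "0 < c" using c log_capacity_nonneg[of E] by simp
    have "\<exists>z :: nat \<Rightarrow> real. (\<forall>i. z i \<in> E) \<and>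
        (\<forall>k\<le>n j. c ^ n j \<le> (\<Prod>i\<in>{..n j} - {k}. \<bar>z k - z i\<bar>))" for j
      using spread_points_if_monic_polys_large[OF E False c0, of "n j"] n(2)[of j] by metis
    then obtain z :: "nat \<Rightarrow> nat \<Rightarrow> real" where z: "\<And>j i. z j i \<in> E"
      "\<And>j k. k \<le> n j \<Longrightarrow> c ^ n j \<le> (\<Prod>i\<in>{..n j} - {k}. \<bar>z j k - z j i\<bar>)"
      by metis
    have "c \<le> log_capacity E"
      by (rule le_log_capacity[OF E c0 filterlim_subseq[OF n(1)] z])
    with c show False by simp
  qed
qed

section \<open>Matrix polynomials and the right inner product\<close>

lemma adj_simps:
  fixes A B :: "'l::finite cmat"
  shows "adj (A ** B) = adj B ** adj A" "adj (adj A) = A" "adj (A + B) = adj A + adj B"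
    "adj (r *\<^sub>R A) = r *\<^sub>R adj A" "adj 0 = (0 :: 'l cmat)" "adj (mat 1) = (mat 1 :: 'l cmat)"
  by (auto simp: adj_def vec_eq_iff matrix_matrix_mult_def mult.commute mat_def)

lemma bounded_linear_adj: "bounded_linear (adj :: 'l::finite cmat \<Rightarrow> 'l cmat)"
  by (simp add: linear_conv_bounded_linear[symmetric] linear_iff adj_simps)

lemma bounded_bilinear_matrix_mult:
  "bounded_bilinear ((**) :: 'l::finite cmat \<Rightarrow> 'l cmat \<Rightarrow> 'l cmat)"
  by (simp add: bilinear_conv_bounded_bilinear[symmetric] bilinear_def linear_iff
      matrix_add_ldistrib matrix_scalar_ac scalar_matrix_assoc[symmetric])
    (simp add: vec_eq_iff matrix_matrix_mult_def distrib_right sum.distrib)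

interpretation mm: bounded_bilinear "(**) :: 'l::finite cmat \<Rightarrow> 'l cmat \<Rightarrow> 'l cmat"
  by (rule bounded_bilinear_matrix_mult)

text \<open>The complement of the support is a union of open null sets, and countably many of them suffice.\<close>

lemma null_complement_matrix_supp:
  assumes \<mu>: "matrix_measure \<mu>"
  shows "AE x in trace_measure \<mu>. x \<in> matrix_supp \<mu>"
proof -
  let ?F = "{U. open U \<and> \<mu> U = 0}"
  obtain F' where F': "F' \<subseteq> ?F" "countable F'" "\<Union>F' = \<Union>?F"
    using Lindelof[of ?F] by auto
  have "U \<in> null_sets (trace_measure \<mu>)" if "U \<in> F'" for U
    using that F'(1) \<mu> by (auto simp: null_sets_def emeasure_trace_measure trace_def)
  then have "\<Union>F' \<in> null_sets (trace_measure \<mu>)"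
    using null_sets_UN'[OF F'(2), of id] by simp
  then show ?thesis
    by (rule AE_I') (auto simp: F'(3) matrix_supp_def)
qed

text \<open>The adjoint of a density is again a density, because the values of the measure are Hermitian;
  densities are unique up to null sets.\<close>

lemma hermitian_trace_density:
  assumes \<mu>: "matrix_measure \<mu>"
  shows "AE x in trace_measure \<mu>. adj (trace_density \<mu> x) = trace_density \<mu> x"
proof -
  note D = is_trace_density_trace_density[OF \<mu>]
  have int: "integrable (trace_measure \<mu>) (trace_density \<mu>)"
    using D by (simp add: is_trace_density_def)
  have "is_trace_density \<mu> (\<lambda>x. adj (trace_density \<mu> x))"
    unfolding is_trace_density_def
  proof (intro conjI ballI)
    show "integrable (trace_measure \<mu>) (\<lambda>x. adj (trace_density \<mu> x))"
      by (rule integrable_bounded_linear[OF bounded_linear_adj int])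
    fix X :: "real set" assume X: "X \<in> sets borel"
    have "(LINT x:X|trace_measure \<mu>. adj (trace_density \<mu> x))
        = (LINT x|trace_measure \<mu>. adj (indicat_real X x *\<^sub>R trace_density \<mu> x))"
      by (simp add: set_lebesgue_integral_def adj_simps)
    also have "\<dots> = adj (LINT x:X|trace_measure \<mu>. trace_density \<mu> x)"
      unfolding set_lebesgue_integral_def using X
      by (intro integral_bounded_linear[OF bounded_linear_adj] integrable_mult_indicator int) auto
    also have "\<dots> = adj (\<mu> X)" using D X by (simp add: is_trace_density_def)
    also have "\<dots> = \<mu> X" using \<mu> X by (simp add: matrix_measure_def psd_def)
    finally show "\<mu> X = (LINT x:X|trace_measure \<mu>. adj (trace_density \<mu> x))" by simp
  qed
  from trace_density_unique[OF \<mu> this D] show ?thesis .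
qed

lemma trace_trace_density:
  assumes \<mu>: "matrix_measure \<mu>"
  shows "AE x in trace_measure \<mu>. Re (trace (trace_density \<mu> x)) = 1"
proof (rule density_unique_real)
  let ?T = "trace_measure \<mu>" and ?M = "trace_density \<mu>"
  interpret finite_measure ?T by (rule finite_trace_measure[OF \<mu>])
  note D = is_trace_density_trace_density[OF \<mu>]
  have int: "integrable ?T ?M"
    using D by (simp add: is_trace_density_def)
  show "integrable ?T (\<lambda>x. Re (trace (?M x)))"
    by (rule integrable_bounded_linear[OF bounded_linear_Re_trace int])
  show "integrable ?T (\<lambda>x. 1)" by simp
  fix X assume "X \<in> sets ?T"
  then have X: "X \<in> sets borel" by simp
  have "(LINT x:X|?T. Re (trace (?M x))) = (LINT x|?T. Re (trace (indicat_real X x *\<^sub>R ?M x)))"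
    by (simp add: set_lebesgue_integral_def linear_simps(5)[OF bounded_linear_Re_trace])
  also have "\<dots> = Re (trace (LINT x:X|?T. ?M x))"
    unfolding set_lebesgue_integral_def using X
    by (intro integral_bounded_linear[OF bounded_linear_Re_trace] integrable_mult_indicator int) auto
  also have "\<dots> = Re (trace (\<mu> X))" using D X by (simp add: is_trace_density_def)
  also have "\<dots> = (LINT x:X|?T. 1)"
  proof -
    have "0 \<le> Re (trace (\<mu> X))"
      using X \<mu> psd_trace unfolding matrix_measure_def by blast
    then show ?thesis
      using X by (simp add: set_lebesgue_integral_def measure_def emeasure_trace_measure[OF \<mu>])
  qed
  finally show "(LINT x:X|?T. Re (trace (?M x))) = (LINT x:X|?T. 1)" .
qed

text \<open>Matrix polynomials of degree less than \<open>n\<close>, as functions. The strict bound lets the zero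
  polynomial alone form the case \<open>n = 0\<close>. Functions are used rather than the type \<open>poly\<close>, since its product
  would involve the entrywise product of matrices.\<close>

definition matpoly_below :: "nat \<Rightarrow> (real \<Rightarrow> 'l::finite cmat) set" where
  "matpoly_below n = {f. \<exists>a. f = (\<lambda>x. \<Sum>i<n. x ^ i *\<^sub>R a i)}"

lemma matpoly_below_0: "f \<in> matpoly_below 0 \<longleftrightarrow> f = (\<lambda>x. 0)"
  by (auto simp: matpoly_below_def)

lemma matpoly_below_add:
  assumes "f \<in> matpoly_below n" "g \<in> matpoly_below n"
  shows "(\<lambda>x. f x + g x) \<in> matpoly_below n"
proof -
  obtain a b where "f = (\<lambda>x. \<Sum>i<n. x ^ i *\<^sub>R a i)" "g = (\<lambda>x. \<Sum>i<n. x ^ i *\<^sub>R b i)"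
    using assms by (auto simp: matpoly_below_def)
  then show ?thesis
    by (auto simp: matpoly_below_def sum.distrib scaleR_add_right intro!: exI[of _ "\<lambda>i. a i + b i"])
qed

lemma matpoly_below_linear:
  assumes "f \<in> matpoly_below n" "linear h"
  shows "(\<lambda>x. h (f x)) \<in> matpoly_below n"
proof -
  obtain a where "f = (\<lambda>x. \<Sum>i<n. x ^ i *\<^sub>R a i)"
    using assms by (auto simp: matpoly_below_def)
  then show ?thesis using assms(2)
    by (auto simp: matpoly_below_def linear_sum linear_scale intro!: exI[of _ "\<lambda>i. h (a i)"])
qed

lemma matpoly_below_uminus: "f \<in> matpoly_below n \<Longrightarrow> (\<lambda>x. - f x) \<in> matpoly_below n"
  by (erule matpoly_below_linear) (simp add: linear_iff)

lemma matpoly_below_mult: "f \<in> matpoly_below n \<Longrightarrow> (\<lambda>x. f x ** X) \<in> matpoly_below n"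
  by (erule matpoly_below_linear) (simp add: linear_iff mm.add_left mm.scaleR_left)

lemma matpoly_below_mono:
  assumes "f \<in> matpoly_below n" "n \<le> m"
  shows "f \<in> matpoly_below m"
proof -
  obtain a where f: "f = (\<lambda>x. \<Sum>i<n. x ^ i *\<^sub>R a i)"
    using assms by (auto simp: matpoly_below_def)
  have "f = (\<lambda>x. \<Sum>i<m. x ^ i *\<^sub>R (if i < n then a i else 0))"
    unfolding f using assms(2)
    by (intro ext sum.mono_neutral_cong_left) auto
  then show ?thesis unfolding matpoly_below_def by (intro CollectI exI)
qed

lemma matpoly_below_Suc:
  "f \<in> matpoly_below (Suc n) \<longleftrightarrow> (\<exists>K. \<exists>r\<in>matpoly_below n. f = (\<lambda>x. x ^ n *\<^sub>R K + r x))"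
proof
  assume "f \<in> matpoly_below (Suc n)"
  then obtain a where f: "f = (\<lambda>x. \<Sum>i<Suc n. x ^ i *\<^sub>R a i)"
    by (auto simp: matpoly_below_def)
  show "\<exists>K. \<exists>r\<in>matpoly_below n. f = (\<lambda>x. x ^ n *\<^sub>R K + r x)"
    by (intro exI[of _ "a n"] bexI[of _ "\<lambda>x. \<Sum>i<n. x ^ i *\<^sub>R a i"])
      (auto simp: f matpoly_below_def add.commute)
next
  assume "\<exists>K. \<exists>r\<in>matpoly_below n. f = (\<lambda>x. x ^ n *\<^sub>R K + r x)"
  then obtain K a where "f = (\<lambda>x. x ^ n *\<^sub>R K + (\<Sum>i<n. x ^ i *\<^sub>R a i))"
    by (auto simp: matpoly_below_def)
  then have "f = (\<lambda>x. \<Sum>i<Suc n. x ^ i *\<^sub>R (a(n := K)) i)"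
    by (auto simp: add.commute fun_eq_iff)
  then show "f \<in> matpoly_below (Suc n)" unfolding matpoly_below_def by blast
qed

lemma matpoly_below_shift:
  assumes "f \<in> matpoly_below n"
  shows "(\<lambda>x. x *\<^sub>R f x) \<in> matpoly_below (Suc n)"
proof -
  obtain a where f: "f = (\<lambda>x. \<Sum>i<n. x ^ i *\<^sub>R a i)"
    using assms by (auto simp: matpoly_below_def)
  have "(\<lambda>x. x *\<^sub>R f x) = (\<lambda>x. \<Sum>i<Suc n. x ^ i *\<^sub>R (case i of 0 \<Rightarrow> 0 | Suc j \<Rightarrow> a j))"
    unfolding f sum.lessThan_Suc_shift by (simp add: scaleR_sum_right)
  then show ?thesis unfolding matpoly_below_def by blast
qed

lemma matpoly_below_eval: "mpoly_eval p \<in> matpoly_below (Suc (degree p))"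
  unfolding matpoly_below_def mpoly_eval_def by (auto simp: lessThan_Suc_atMost)

lemma matpoly_below_imp_eval:
  assumes "f \<in> matpoly_below n"
  obtains p where "f = mpoly_eval p"
proof -
  obtain a where f: "f = (\<lambda>x. \<Sum>i<n. x ^ i *\<^sub>R a i)"
    using assms by (auto simp: matpoly_below_def)
  define p where "p = Poly (map a [0..<n])"
  have c: "coeff p i = (if i < n then a i else 0)" for i
    by (simp add: p_def nth_default_def)
  have "f x = mpoly_eval p x" for x
  proof -
    have "f x = (\<Sum>i<max n (Suc (degree p)). x ^ i *\<^sub>R coeff p i)"
      unfolding f by (intro sum.mono_neutral_cong_left) (auto simp: c)
    also have "\<dots> = (\<Sum>i\<le>degree p. x ^ i *\<^sub>R coeff p i)"
      by (intro sum.mono_neutral_right) (auto simp: coeff_eq_0)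
    finally show ?thesis by (simp add: mpoly_eval_def)
  qed
  then show thesis using that by blast
qed

locale compact_matrix_measure =
  fixes \<mu> :: "real set \<Rightarrow> 'l::finite cmat"
  assumes matrix_measure: "matrix_measure \<mu>"
    and compact_supp: "compact (matrix_supp \<mu>)"
begin

lemma integrable_density: "integrable (trace_measure \<mu>) (trace_density \<mu>)"
  using is_trace_density_trace_density[OF matrix_measure] by (simp add: is_trace_density_def)

text \<open>A continuous function is bounded on the compact support, and the support carries all the mass.\<close>

lemma integrable_continuous_density:
  fixes q :: "real \<Rightarrow> real"
  assumes "continuous_on UNIV q"
  shows "integrable (trace_measure \<mu>) (\<lambda>x. q x *\<^sub>R trace_density \<mu> x)"
proof -
  obtain B where B: "\<And>x. x \<in> matrix_supp \<mu> \<Longrightarrow> \<bar>q x\<bar> \<le> B"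
    using compact_imp_bounded[OF compact_continuous_image[OF continuous_on_subset[OF assms] compact_supp]]
    by (auto simp: bounded_iff)
  have [measurable]: "q \<in> borel_measurable borel"
    using assms by (rule borel_measurable_continuous_onI)
  have [measurable]: "trace_density \<mu> \<in> borel_measurable (trace_measure \<mu>)"
    using integrable_density by (rule borel_measurable_integrable)
  have "AE x in trace_measure \<mu>. norm (q x *\<^sub>R trace_density \<mu> x) \<le> norm (B *\<^sub>R trace_density \<mu> x)"
    using null_complement_matrix_supp[OF matrix_measure]
  proof eventually_elim
    case (elim x)
    then have "\<bar>q x\<bar> \<le> \<bar>B\<bar>" using B[of x] by linarith
    then show ?case by (simp add: mult_right_mono)
  qed
  then show ?thesis
    by (intro Bochner_Integration.integrable_bound[OF integrable_scaleR_right[OF integrable_density, of B]]) auto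
qed

lemma integrable_right_inner:
  assumes "f \<in> matpoly_below n" "g \<in> matpoly_below m"
  shows "integrable (trace_measure \<mu>) (\<lambda>x. adj (f x) ** trace_density \<mu> x ** g x)"
proof -
  obtain a b where f: "f = (\<lambda>x. \<Sum>i<n. x ^ i *\<^sub>R a i)" and g: "g = (\<lambda>x. \<Sum>i<m. x ^ i *\<^sub>R b i)"
    using assms by (auto simp: matpoly_below_def)
  have bl: "bounded_linear (\<lambda>M. adj A ** M ** B)" for A B :: "'l cmat"
    by (intro bounded_linear_compose[OF mm.bounded_linear_left mm.bounded_linear_right])
  have "(\<lambda>x. adj (f x) ** trace_density \<mu> x ** g x)
      = (\<lambda>x. \<Sum>j<m. \<Sum>i<n. adj (a i) ** (x ^ (i + j) *\<^sub>R trace_density \<mu> x) ** b j)"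
    by (simp add: f g linear_sum[OF bounded_linear.linear[OF bounded_linear_adj]] adj_simps
        mm.sum_left mm.sum_right mm.scaleR_left mm.scaleR_right power_add mult.commute
        scaleR_sum_right)
  moreover have "integrable (trace_measure \<mu>)
      (\<lambda>x. \<Sum>j<m. \<Sum>i<n. adj (a i) ** (x ^ (i + j) *\<^sub>R trace_density \<mu> x) ** b j)"
    by (intro Bochner_Integration.integrable_sum integrable_bounded_linear[OF bl]
        integrable_continuous_density continuous_intros)
  ultimately show ?thesis by simp
qed

lemma right_inner_add:
  assumes "f \<in> matpoly_below n" "g \<in> matpoly_below m" "h \<in> matpoly_below m'"
  shows "right_inner \<mu> f (\<lambda>x. g x + h x) = right_inner \<mu> f g + right_inner \<mu> f h"
  unfolding right_inner_def
  by (simp add: mm.add_right integrable_right_inner[OF assms(1,2)] integrable_right_inner[OF assms(1,3)])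

lemma right_inner_mult:
  assumes "f \<in> matpoly_below n" "g \<in> matpoly_below m"
  shows "right_inner \<mu> f (\<lambda>x. g x ** X) = right_inner \<mu> f g ** X"
  unfolding right_inner_def
  by (simp add: matrix_mul_assoc integral_bounded_linear[OF mm.bounded_linear_left integrable_right_inner[OF assms]])

lemma right_inner_uminus: "right_inner \<mu> f (\<lambda>x. - g x) = - right_inner \<mu> f g"
  unfolding right_inner_def by (simp add: mm.minus_right)

lemma right_inner_zero: "right_inner \<mu> f (\<lambda>x. 0) = 0"
  unfolding right_inner_def by simp

lemma adj_right_inner:
  assumes "f \<in> matpoly_below n" "g \<in> matpoly_below m"
  shows "adj (right_inner \<mu> f g) = right_inner \<mu> g f"
proof -
  have "adj (right_inner \<mu> f g)
      = (LINT x|trace_measure \<mu>. adj (adj (f x) ** trace_density \<mu> x ** g x))"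
    unfolding right_inner_def
    by (rule integral_bounded_linear[OF bounded_linear_adj integrable_right_inner[OF assms], symmetric])
  also have "\<dots> = right_inner \<mu> g f"
    unfolding right_inner_def
  proof (rule integral_cong_AE)
    show "(\<lambda>x. adj (adj (f x) ** trace_density \<mu> x ** g x)) \<in> borel_measurable (trace_measure \<mu>)"
      by (intro borel_measurable_integrable integrable_bounded_linear[OF bounded_linear_adj]
          integrable_right_inner[OF assms])
    show "(\<lambda>x. adj (g x) ** trace_density \<mu> x ** f x) \<in> borel_measurable (trace_measure \<mu>)"
      by (intro borel_measurable_integrable integrable_right_inner[OF assms(2,1)])
    show "AE x in trace_measure \<mu>. adj (adj (f x) ** trace_density \<mu> x ** g x)
        = adj (g x) ** trace_density \<mu> x ** f x"
      using hermitian_trace_density[OF matrix_measure]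
      by eventually_elim (simp add: adj_simps matrix_mul_assoc)
  qed
  finally show ?thesis .
qed

lemma right_inner_shift:
  "right_inner \<mu> (\<lambda>x. x *\<^sub>R f x) g = right_inner \<mu> f (\<lambda>x. x *\<^sub>R g x)"
  unfolding right_inner_def by (simp add: adj_simps mm.scaleR_left mm.scaleR_right)

end

section \<open>Orthonormal matrix polynomials\<close>

text \<open>From the Leibniz formula. The constant is far from the sharp one of Hadamard's inequality, but it
  depends only on the size of the matrix and so disappears under the \<open>n\<close>-th root.\<close>

lemma cmod_det_le:
  fixes X :: "'l::finite cmat"
  assumes "\<And>i j. cmod (X $ i $ j) \<le> b"
  shows "cmod (det X) \<le> fact CARD('l) * b ^ CARD('l)"
proof -
  have "cmod (det X) \<le> (\<Sum>p | p permutes (UNIV :: 'l set). b ^ CARD('l))"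
    unfolding det_def
  proof (rule sum_norm_le)
    fix p :: "'l \<Rightarrow> 'l"
    have "(\<Prod>i\<in>UNIV. cmod (X $ i $ p i)) \<le> (\<Prod>i\<in>(UNIV :: 'l set). b)"
      by (intro prod_mono) (simp add: assms)
    then show "cmod (of_int (sign p) * (\<Prod>i\<in>UNIV. X $ i $ p i)) \<le> b ^ CARD('l)"
      by (simp add: norm_mult prod_norm sign_def)
  qed
  then show ?thesis by (simp add: card_permutations)
qed

locale orthonormal_matpolys = compact_matrix_measure \<mu>
  for \<mu> :: "real set \<Rightarrow> 'l::finite cmat" +
  fixes p :: "nat \<Rightarrow> 'l cmat poly"
  assumes nontrivial: "nontrivial_measure \<mu>"
    and orthonormal: "right_orthonormal \<mu> p"
begin

abbreviation P :: "nat \<Rightarrow> real \<Rightarrow> 'l cmat" where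
  "P n \<equiv> mpoly_eval (p n)"

lemma P_below: "P n \<in> matpoly_below (Suc n)"
proof -
  have "degree (p n) = n"
    using orthonormal unfolding right_orthonormal_def by blast
  then show ?thesis using matpoly_below_eval[of "p n"] by metis
qed

lemma P_inner: "right_inner \<mu> (P n) (P m) = (if n = m then mat 1 else 0)"
  using orthonormal unfolding right_orthonormal_def by blast

text \<open>The leading coefficient \<open>K\<close> of \<open>P n\<close> is invertible: if \<open>K ** X = 0\<close>, then \<open>P n ** X\<close> has lower
  degree, is therefore orthogonal to \<open>P n\<close>, and \<open>X = \<langle>P n, P n ** X\<rangle> = 0\<close>. Hence a right multiple of \<open>P n\<close>
  removes any leading term. Orthogonality is a hypothesis here because its proof uses this division in
  lower degrees.\<close>

lemma split_leading_if_orthogonal: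
  assumes orth: "\<And>f. f \<in> matpoly_below n \<Longrightarrow> right_inner \<mu> (P n) f = 0"
    and f: "f \<in> matpoly_below (Suc n)"
  shows "\<exists>Y. \<exists>s\<in>matpoly_below n. f = (\<lambda>x. P n x ** Y + s x)"
proof -
  obtain K r where r: "r \<in> matpoly_below n" and P: "P n = (\<lambda>x. x ^ n *\<^sub>R K + r x)"
    using P_below[of n] by (auto simp: matpoly_below_Suc)
  have "v = 0" if "K *v v = 0" for v
  proof -
    \<comment> \<open>A kernel vector is turned into a matrix, all of whose columns equal it.\<close>
    define X :: "'l cmat" where "X = (\<chi> i j. v $ i)"
    have "K ** X = 0"
      using that by (simp add: X_def vec_eq_iff matrix_matrix_mult_def matrix_vector_mult_def)
    then have "(\<lambda>x. P n x ** X) = (\<lambda>x. r x ** X)"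
      by (simp add: P mm.add_left mm.scaleR_left)
    then have "right_inner \<mu> (P n) (\<lambda>x. P n x ** X) = 0"
      using orth[OF matpoly_below_mult[OF r]] by simp
    then have "X = 0" by (simp add: right_inner_mult[OF P_below P_below] P_inner)
    then show "v = 0" by (simp add: X_def vec_eq_iff)
  qed
  then obtain K' where K': "K ** K' = mat 1"
    using matrix_left_invertible_ker[of K] matrix_left_right_inverse[of _ K] by blast
  obtain F s where s: "s \<in> matpoly_below n" and f: "f = (\<lambda>x. x ^ n *\<^sub>R F + s x)"
    using f by (auto simp: matpoly_below_Suc)
  let ?Y = "K' ** F"
  have "K ** ?Y = F" by (simp add: matrix_mul_assoc K')
  then have "f = (\<lambda>x. P n x ** ?Y + (s x + - (r x ** ?Y)))"
    by (simp add: f P mm.add_left mm.scaleR_left)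
  moreover have "(\<lambda>x. s x + - (r x ** ?Y)) \<in> matpoly_below n"
    by (intro matpoly_below_add matpoly_below_uminus matpoly_below_mult s r)
  ultimately show ?thesis
    by (intro exI[of _ ?Y] bexI[of _ "\<lambda>x. s x + - (r x ** ?Y)"])
qed

lemma P_orthogonal_below:
  "f \<in> matpoly_below n \<Longrightarrow> n \<le> m \<Longrightarrow> right_inner \<mu> (P m) f = 0"
proof (induction n arbitrary: f m)
  case 0
  then show ?case by (simp add: matpoly_below_0 right_inner_zero)
next
  case (Suc n)
  obtain Y s where s: "s \<in> matpoly_below n" and f: "f = (\<lambda>x. P n x ** Y + s x)"
    using split_leading_if_orthogonal[of n f] Suc.IH Suc.prems(1) by blast
  have "right_inner \<mu> (P m) f = right_inner \<mu> (P m) (P n) ** Y + right_inner \<mu> (P m) s"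
    unfolding f by (simp add: right_inner_add[OF P_below matpoly_below_mult[OF P_below] s]
        right_inner_mult[OF P_below P_below])
  then show ?case using Suc.prems(2) Suc.IH[OF s, of m] by (simp add: P_inner)
qed

lemma split_leading:
  "f \<in> matpoly_below (Suc n) \<Longrightarrow> \<exists>Y. \<exists>s\<in>matpoly_below n. f = (\<lambda>x. P n x ** Y + s x)"
  by (rule split_leading_if_orthogonal) (rule P_orthogonal_below, auto)

text \<open>For scalar monic polynomials \<open>q\<close> of degree \<open>n\<close>, this is \<open>\<langle>P n, q\<rangle>\<close>, as \<open>P n\<close> is orthogonal to lower
  degrees; it is also the inverse of the leading coefficient of \<open>P n\<close>.\<close>

definition monomial_coeff :: "nat \<Rightarrow> 'l cmat" where
  "monomial_coeff n = right_inner \<mu> (P n) (\<lambda>x. x ^ n *\<^sub>R mat 1)"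

lemma power_below: "(\<lambda>x. x ^ n *\<^sub>R X) \<in> matpoly_below (Suc n)"
proof -
  have "(\<lambda>x. 0) \<in> matpoly_below n"
    by (rule matpoly_below_mono[of _ 0]) (simp_all add: matpoly_below_0)
  then show ?thesis
    unfolding matpoly_below_Suc by (intro exI[of _ X] bexI[of _ "\<lambda>x. 0"]) auto
qed

text \<open>Moving one factor \<open>x\<close> to the other side of \<open>\<langle>P (n + 1), x ^ (n + 1)\<rangle>\<close> and dividing \<open>x ^ n\<close> by \<open>P n\<close>, whose
  quotient is \<open>monomial_coeff n\<close>, leaves
  \<open>\<langle>P (n + 1), x P n\<rangle> ** monomial_coeff n\<close>: the remainder has too low a degree to matter.\<close>

lemma monomial_coeff_Suc:
  "monomial_coeff (Suc n) = adj (right_inner \<mu> (P n) (\<lambda>x. x *\<^sub>R P (Suc n) x)) ** monomial_coeff n"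
proof -
  obtain Y s where s: "s \<in> matpoly_below n"
    and eq: "(\<lambda>x. x ^ n *\<^sub>R mat 1) = (\<lambda>x. P n x ** Y + s x)"
    using split_leading[OF power_below[of n "mat 1"]] by blast
  have Y: "monomial_coeff n = Y"
    unfolding monomial_coeff_def eq
    by (simp add: right_inner_add[OF P_below matpoly_below_mult[OF P_below] s]
        right_inner_mult[OF P_below P_below] P_inner P_orthogonal_below[OF s])
  have xP: "(\<lambda>x. x *\<^sub>R P n x) \<in> matpoly_below (Suc (Suc n))"
    and xs: "(\<lambda>x. x *\<^sub>R s x) \<in> matpoly_below (Suc n)"
    by (intro matpoly_below_shift P_below s)+
  have "(\<lambda>x. x ^ Suc n *\<^sub>R mat 1) = (\<lambda>x. x *\<^sub>R (x ^ n *\<^sub>R mat 1))" by simp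
  also have "\<dots> = (\<lambda>x. (x *\<^sub>R P n x) ** Y + x *\<^sub>R s x)"
    using eq by (simp add: fun_eq_iff scaleR_add_right mm.scaleR_left)
  finally have "monomial_coeff (Suc n) = right_inner \<mu> (P (Suc n)) (\<lambda>x. x *\<^sub>R P n x) ** Y"
    unfolding monomial_coeff_def
    by (simp add: right_inner_add[OF P_below matpoly_below_mult[OF xP] xs]
        right_inner_mult[OF P_below xP] P_orthogonal_below[OF xs])
  also have "right_inner \<mu> (P (Suc n)) (\<lambda>x. x *\<^sub>R P n x)
      = adj (right_inner \<mu> (P n) (\<lambda>x. x *\<^sub>R P (Suc n) x))"
    by (simp add: adj_right_inner[OF xP P_below, symmetric] right_inner_shift)
  finally show ?thesis by (simp add: Y)
qed

lemma monomial_coeff_eq_adj_prod: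
  assumes A: "\<And>n. 1 \<le> n \<Longrightarrow> A n = right_inner \<mu> (P (n - 1)) (\<lambda>x. x *\<^sub>R P n x)"
  shows "monomial_coeff n = adj (mat_prod_upto A n)"
proof (induction n)
  case 0
  have "p 0 = [:mat 1:]"
    using orthonormal unfolding right_orthonormal_def by blast
  then have "(\<lambda>x. x ^ 0 *\<^sub>R mat 1) = P 0"
    by (intro ext) (simp add: mpoly_eval_def)
  then have "monomial_coeff 0 = right_inner \<mu> (P 0) (P 0)"
    unfolding monomial_coeff_def by (rule arg_cong)
  also have "\<dots> = mat 1" by (subst P_inner) simp
  finally show ?case by (simp add: adj_simps)
next
  case (Suc n)
  have "A (Suc n) = right_inner \<mu> (P n) (\<lambda>x. x *\<^sub>R P (Suc n) x)"
    using A[of "Suc n"] by simp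
  with Suc show ?case by (simp only: monomial_coeff_Suc mat_prod_upto.simps adj_simps)
qed

text \<open>Positivity is taken from non-triviality, which speaks of non-zero polynomials, rather than from
  positivity of the density.\<close>

lemma trace_right_inner_nonneg:
  assumes "f \<in> matpoly_below n"
  shows "0 \<le> Re (trace (right_inner \<mu> f f))"
proof -
  obtain q where q: "f = mpoly_eval q" using matpoly_below_imp_eval[OF assms] .
  show ?thesis
  proof (cases "q = 0")
    case True
    then have "f = (\<lambda>x. 0)" by (simp add: q mpoly_eval_def fun_eq_iff)
    then show ?thesis by (simp add: right_inner_zero trace_def)
  next
    case False
    then show ?thesis
      using nontrivial unfolding nontrivial_measure_def q by (auto intro: less_imp_le)
  qed
qed

text \<open>With \<open>f = P n ** Y - g\<close>, the projection identity \<open>\<langle>f, f\<rangle> = \<langle>g, g\<rangle> - adj Y ** Y\<close> holds since \<open>f\<close> is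
  orthogonal to \<open>P n\<close>.\<close>

lemma bessel_inequality:
  fixes n :: nat
  assumes g: "g \<in> matpoly_below m"
  defines "Y \<equiv> right_inner \<mu> (P n) g"
  shows "Re (trace (adj Y ** Y)) \<le> Re (trace (right_inner \<mu> g g))"
proof -
  define f where "f = (\<lambda>x. P n x ** Y + - g x)"
  have PY: "(\<lambda>x. P n x ** Y) \<in> matpoly_below (Suc n)"
    by (rule matpoly_below_mult[OF P_below])
  have g': "(\<lambda>x. - g x) \<in> matpoly_below m" by (rule matpoly_below_uminus[OF g])
  have f: "f \<in> matpoly_below (max (Suc n) m)"
    unfolding f_def by (intro matpoly_below_add matpoly_below_mono[OF PY] matpoly_below_mono[OF g']) auto
  have expand: "right_inner \<mu> h f = right_inner \<mu> h (P n) ** Y - right_inner \<mu> h g"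
    if "h \<in> matpoly_below k" for h k
    unfolding f_def right_inner_add[OF that PY g'] right_inner_mult[OF that P_below] right_inner_uminus
    by simp
  have "right_inner \<mu> (P n) f = 0"
    by (simp add: expand[OF P_below] P_inner Y_def)
  then have fP: "right_inner \<mu> f (P n) = 0"
    using adj_right_inner[OF P_below f, of n] by (simp add: adj_simps)
  have "right_inner \<mu> g (P n) = adj Y"
    unfolding Y_def by (rule adj_right_inner[OF P_below g, symmetric])
  then have "right_inner \<mu> f g = adj (adj Y ** Y - right_inner \<mu> g g)"
    using adj_right_inner[OF g f] expand[OF g] by simp
  also have "\<dots> = adj Y ** Y - right_inner \<mu> g g"
    by (simp add: linear_simps(2)[OF bounded_linear_adj] adj_simps adj_right_inner[OF g g])
  finally have "right_inner \<mu> f f = right_inner \<mu> g g - adj Y ** Y"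
    by (simp add: expand[OF f] fP)
  then show ?thesis
    using trace_right_inner_nonneg[OF f] by (simp add: trace_sub)
qed

lemma trace_adj_mult: "Re (trace (adj Y ** Y)) = (\<Sum>j\<in>UNIV. \<Sum>i\<in>UNIV. (cmod (Y $ i $ j))\<^sup>2)"
  for Y :: "'n::finite cmat"
proof -
  have sq: "Re (cnj w * w) = (cmod w)\<^sup>2" for w
    by (metis Re_complex_of_real complex_norm_square mult.commute)
  show ?thesis
    by (simp only: trace_def matrix_matrix_mult_def adj_def vec_lambda_beta Re_sum sq)
qed

text \<open>For scalar polynomials only the trace of the density enters, which is \<open>1\<close> almost everywhere, and
  the trace measure has total mass \<open>l\<close>.\<close>

lemma trace_right_inner_scalar_le:
  assumes q: "\<And>x. x \<in> matrix_supp \<mu> \<Longrightarrow> \<bar>poly q x\<bar> \<le> s"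
  defines "g \<equiv> \<lambda>x. poly q x *\<^sub>R (mat 1 :: 'l cmat)"
  shows "Re (trace (right_inner \<mu> g g)) \<le> s\<^sup>2 * CARD('l)"
proof -
  let ?T = "trace_measure \<mu>" and ?M = "trace_density \<mu>"
  interpret finite_measure ?T by (rule finite_trace_measure[OF matrix_measure])
  have int: "integrable ?T (\<lambda>x. (poly q x)\<^sup>2 *\<^sub>R ?M x)"
    by (intro integrable_continuous_density continuous_intros)
  have "Re (trace (right_inner \<mu> g g)) = Re (trace (LINT x|?T. (poly q x)\<^sup>2 *\<^sub>R ?M x))"
    by (simp add: right_inner_def g_def adj_simps mm.scaleR_left mm.scaleR_right power2_eq_square)
  also have "\<dots> = (LINT x|?T. Re (trace ((poly q x)\<^sup>2 *\<^sub>R ?M x)))"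
    by (rule integral_bounded_linear[OF bounded_linear_Re_trace int, symmetric])
  also have "\<dots> \<le> (LINT x|?T. s\<^sup>2)"
  proof (rule integral_mono_AE)
    show "integrable ?T (\<lambda>x. Re (trace ((poly q x)\<^sup>2 *\<^sub>R ?M x)))"
      by (rule integrable_bounded_linear[OF bounded_linear_Re_trace int])
    show "AE x in ?T. Re (trace ((poly q x)\<^sup>2 *\<^sub>R ?M x)) \<le> s\<^sup>2"
      using trace_trace_density[OF matrix_measure] null_complement_matrix_supp[OF matrix_measure]
    proof eventually_elim
      case (elim x)
      then show ?case
        using q[of x] power_mono[of "\<bar>poly q x\<bar>" s 2]
        by (simp add: linear_simps(5)[OF bounded_linear_Re_trace])
    qed
  qed simp
  also have "\<dots> = s\<^sup>2 * CARD('l)"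
  proof -
    have "\<mu> UNIV = mat 1" using matrix_measure by (simp add: matrix_measure_def)
    then show ?thesis
      by (simp add: measure_def emeasure_trace_measure[OF matrix_measure] trace_I mult.commute)
  qed
  finally show ?thesis .
qed

text \<open>Bessel's inequality for a scalar monic polynomial bounds the Hilbert-Schmidt norm of \<open>monomial_coeff n\<close>, and
  hence every entry.\<close>

lemma cmod_monomial_coeff_entry_le:
  assumes q: "degree q = n" "lead_coeff q = 1"
    and s: "\<And>x. x \<in> matrix_supp \<mu> \<Longrightarrow> \<bar>poly q x\<bar> \<le> s" "0 \<le> s"
  shows "cmod (monomial_coeff n $ i $ j) \<le> s * sqrt CARD('l)"
proof -
  define g where "g = (\<lambda>x. poly q x *\<^sub>R (mat 1 :: 'l cmat))"
  define r where "r = (\<lambda>x. \<Sum>k<n. x ^ k *\<^sub>R (coeff q k *\<^sub>R (mat 1 :: 'l cmat)))"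
  have r: "r \<in> matpoly_below n"
    unfolding r_def matpoly_below_def
    by (intro CollectI exI[of _ "\<lambda>k. coeff q k *\<^sub>R mat 1"] refl)
  have g_eq: "g = (\<lambda>x. x ^ n *\<^sub>R mat 1 + r x)"
  proof
    fix x
    have "poly q x = (\<Sum>k<Suc n. coeff q k * x ^ k)"
      by (simp only: poly_altdef q(1) lessThan_Suc_atMost)
    also have "\<dots> = x ^ n + (\<Sum>k<n. x ^ k * coeff q k)"
      using q by (simp add: mult.commute)
    finally show "g x = x ^ n *\<^sub>R mat 1 + r x"
      by (simp add: g_def r_def scaleR_add_left scaleR_sum_left)
  qed
  have g: "g \<in> matpoly_below (Suc n)"
    unfolding matpoly_below_Suc using r g_eq by blast
  have "right_inner \<mu> (P n) g = monomial_coeff n"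
    unfolding g_eq
    by (simp add: right_inner_add[OF P_below power_below r] monomial_coeff_def P_orthogonal_below[OF r])
  then have "Re (trace (adj (monomial_coeff n) ** monomial_coeff n)) \<le> s\<^sup>2 * CARD('l)"
    using bessel_inequality[OF g, of n] trace_right_inner_scalar_le[of q s] s(1)
    by (simp add: g_def)
  moreover have "(cmod (monomial_coeff n $ i $ j))\<^sup>2 \<le> (\<Sum>i\<in>UNIV. (cmod (monomial_coeff n $ i $ j))\<^sup>2)"
    by (rule member_le_sum) auto
  moreover have "(\<Sum>i\<in>UNIV. (cmod (monomial_coeff n $ i $ j))\<^sup>2) \<le> Re (trace (adj (monomial_coeff n) ** monomial_coeff n))"
    unfolding trace_adj_mult by (rule member_le_sum) (auto intro: sum_nonneg)
  ultimately have "(cmod (monomial_coeff n $ i $ j))\<^sup>2 \<le> (s * sqrt CARD('l))\<^sup>2"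
    by (simp add: power_mult_distrib)
  moreover have "0 \<le> s * sqrt CARD('l)" using s(2) by simp
  ultimately show ?thesis by (rule power2_le_imp_le)
qed

end

section \<open>The bound by the capacity\<close>

theorem theorem5p1:
  fixes \<mu> :: "real set \<Rightarrow> complex ^ 'l ^ 'l::finite"
    and A B :: "nat \<Rightarrow> complex ^ 'l ^ 'l"
  assumes "matrix_measure \<mu>"
    and "nontrivial_measure \<mu>"
    and "compact (matrix_supp \<mu>)"
    and "jacobi_parameters \<mu> A B"
  shows "limsup (\<lambda>n. ereal (root n (cmod (det (mat_prod_upto A n)))))
           \<le> ereal (log_capacity (matrix_supp \<mu>) ^ CARD('l))"
proof -
  let ?E = "matrix_supp \<mu>"
  let ?a = "\<lambda>n. root n (cmod (det (mat_prod_upto A n)))"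
  define L where "L = limsup (\<lambda>n. ereal (?a n))"
  obtain p where p: "right_orthonormal \<mu> p"
    and A: "\<And>n. 1 \<le> n \<Longrightarrow> A n = right_inner \<mu> (mpoly_eval (p (n - 1))) (\<lambda>x. x *\<^sub>R mpoly_eval (p n) x)"
    using assms(4) unfolding jacobi_parameters_def by blast
  interpret orthonormal_matpolys \<mu> p
    using assms p by unfold_locales
  define K :: real where "K = fact CARD('l) * sqrt CARD('l) ^ CARD('l)"
  have K: "0 < K" by (simp add: K_def)
  have bound: "L \<le> ereal (c ^ CARD('l))" if c: "log_capacity ?E < c" for c
  proof -
    have c0: "0 < c" using c log_capacity_nonneg[of ?E] by simp
    have "\<forall>\<^sub>F n in sequentially. ?a n \<le> root n K * c ^ CARD('l)"
      using monic_poly_small_on_compact[OF assms(3) c] eventually_gt_at_top[of 0]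
    proof eventually_elim
      case (elim n)
      then obtain Q :: "real poly" where Q: "degree Q = n" "lead_coeff Q = 1"
        "\<And>x. x \<in> ?E \<Longrightarrow> \<bar>poly Q x\<bar> \<le> c ^ n" by blast
      have "cmod (mat_prod_upto A n $ i $ j) \<le> c ^ n * sqrt CARD('l)" for i j
        using cmod_monomial_coeff_entry_le[OF Q, of j i] c0 by (simp add: monomial_coeff_eq_adj_prod[OF A] adj_def)
      then have "cmod (det (mat_prod_upto A n)) \<le> fact CARD('l) * (c ^ n * sqrt CARD('l)) ^ CARD('l)"
        by (rule cmod_det_le)
      also have "\<dots> = K * (c ^ CARD('l)) ^ n"
        by (simp add: K_def power_mult_distrib power_mult[symmetric] mult.commute)
      finally have "?a n \<le> root n (K * (c ^ CARD('l)) ^ n)"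
        using elim(2) by simp
      also have "\<dots> = root n K * c ^ CARD('l)"
        using elim(2) c0 by (simp add: real_root_mult real_root_power_cancel)
      finally show ?case .
    qed
    then have "L \<le> limsup (\<lambda>n. ereal (root n K * c ^ CARD('l)))"
      unfolding L_def by (intro Limsup_mono) (auto elim: eventually_mono)
    also have "\<dots> = ereal (1 * c ^ CARD('l))"
      by (intro lim_imp_Limsup tendsto_intros LIMSEQ_root_const K) auto
    finally show ?thesis by simp
  qed
  have "L \<le> ereal (log_capacity ?E ^ CARD('l))"
  proof (rule tendsto_lowerbound)
    show "((\<lambda>c. ereal (c ^ CARD('l))) \<longlongrightarrow> ereal (log_capacity ?E ^ CARD('l))) (at_right (log_capacity ?E))"
      by (intro tendsto_intros)
    show "\<forall>\<^sub>F c in at_right (log_capacity ?E). L \<le> ereal (c ^ CARD('l))"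
      using eventually_at_right_less[of "log_capacity ?E"] by eventually_elim (rule bound)
  qed simp
  then show ?thesis by (simp add: L_def)
qed

end
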